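(* For any positive integers $1\le d\le N$ and any Young diagrams $\alpha,\beta\vdash d$, $$\langle\omega_\alpha\Omega_N^{-1}\omega_\beta\rangle = \sum_{r=0}^\infty (-1)^r\frac{\vec{W}^r(\alpha,\beta)}{N^r}\quad\text{and}\quad \langle\Omega_N^{-1}\omega_\beta\rangle = \sum_{r=0}^\infty(-1)^r\frac{\vec{W}^r(\beta)}{N^r},$$ and both series are absolutely convergent.
   Context: For $\lambda\vdash d$: $\dim\mathsf{V}^\lambda$ is the dimension of the irreducible $\mathrm{S}(d)$-representation indexed by $\lambda$, $\chi_\alpha(\lambda)$ its character on the conjugacy class $C_\alpha$ of permutations of cycle type $\alpha$, and $\omega_\alpha(\lambda)=|C_\alpha|\chi_\alpha(\lambda)/\dim\mathsf{V}^\lambda$. The content of a cell $\Box$ is its column index minus its row index, and $\Omega_N(\lambda) = \prod_{\Box\in\lambda}(1+c(\Box)/N)$, $\Omega_N^{-1}=1/\Omega_N$. Since $d\le N$, the expectations are with respect to Plancherel measure on all $\lambda\vdash d$: $\langle f\rangle = \sum_{\lambda\vdash d} f(\lambda)(\dim\mathsf{V}^\lambda)^2/d!$. For $r\ge0$, $\vec{W}^r(\alpha,\beta)$ is the number of tuples $(\rho,\tau_1,\dots,\tau_r)$ with $\rho\in\mathrm{S}(d)$ of cycle type $\alpha$, each $\tau_s=(i_s\ j_s)$ a transposition with $i_s<j_s$, $j_1\le j_2\le\dots\le j_r$, and $\rho\tau_1\cdots\tau_r$ of cycle type $\beta$ (monotone $r$-step walks on the transposition Cayley graph of $\mathrm{S}(d)$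 from $C_\alpha$ to $C_\beta$); $\vec{W}^r(\beta)=\vec{W}^r((1^d),\beta)$. *)

theory Defs
  imports
    Complex_Main
    "HOL-Combinatorics.Permutations"
    "HOL-Combinatorics.Orbits"
    "HOL-Library.Function_Algebras"
begin

section \<open>Young diagrams\<close>

text \<open>A Young diagram is the weakly decreasing list of its (positive) row lengths.\<close>

definition partitions_of :: "nat \<Rightarrow> nat list set" where
  "partitions_of d = {\<nu>. sorted_wrt (\<ge>) \<nu> \<and> 0 \<notin> set \<nu> \<and> sum_list \<nu> = d}"

text \<open>Cells are pairs (row, column), both numbered from 0.\<close>

definition cells :: "nat list \<Rightarrow> (nat \<times> nat) set" where
  "cells \<nu> = {(i, j). i < length \<nu> \<and> j < \<nu> ! i}"

definition content :: "nat \<times> nat \<Rightarrow> int" where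
  "content c = int (snd c) - int (fst c)"

definition Omega :: "nat \<Rightarrow> nat list \<Rightarrow> complex" where
  "Omega N \<nu> = (\<Prod>c\<in>cells \<nu>. 1 + of_int (content c) / of_nat N)"


section \<open>The symmetric group\<close>

definition Sym :: "nat \<Rightarrow> (nat \<Rightarrow> nat) set" where
  "Sym d = {p. p permutes {1..d}}"

definition cycle_type :: "nat \<Rightarrow> (nat \<Rightarrow> nat) \<Rightarrow> nat multiset" where
  "cycle_type d p = image_mset card (mset_set (orbit p ` {1..d}))"

definition conj_class :: "nat \<Rightarrow> nat list \<Rightarrow> (nat \<Rightarrow> nat) set" where
  "conj_class d \<alpha> = {p \<in> Sym d. cycle_type d p = mset \<alpha>}"


section \<open>Complex vector spaces of functions; traces\<close>

definition scale_fun :: "complex \<Rightarrow> ('a \<Rightarrow> complex) \<Rightarrow> 'a \<Rightarrow> complex" where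
  "scale_fun c f = (\<lambda>x. c * f x)"

interpretation cfun: vector_space "scale_fun :: complex \<Rightarrow> ('a \<Rightarrow> complex) \<Rightarrow> 'a \<Rightarrow> complex"
  by unfold_locales (auto simp: scale_fun_def fun_eq_iff algebra_simps)

definition some_basis :: "('a \<Rightarrow> complex) set \<Rightarrow> ('a \<Rightarrow> complex) set" where
  "some_basis V = (SOME B. B \<subseteq> V \<and> cfun.independent B \<and> cfun.span B = V)"

text \<open>Trace of the restriction of \<open>T\<close> to a finite-dimensional \<open>T\<close>-invariant subspace \<open>V\<close>:
  the sum of the diagonal entries of its matrix with respect to a basis of \<open>V\<close>.\<close>

definition trace_on ::
    "('a \<Rightarrow> complex) set \<Rightarrow> (('a \<Rightarrow> complex) \<Rightarrow> 'a \<Rightarrow> complex) \<Rightarrow> complex" where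
  "trace_on V T = (\<Sum>b\<in>some_basis V. cfun.representation (some_basis V) (T b) b)"


section \<open>The irreducible representations of the symmetric group\<close>

text \<open>The group algebra over the complex numbers: functions vanishing outside \<open>Sym d\<close>,
  with the convolution product.\<close>

definition group_algebra :: "nat \<Rightarrow> ((nat \<Rightarrow> nat) \<Rightarrow> complex) set" where
  "group_algebra d = {x. \<forall>p. p \<notin> Sym d \<longrightarrow> x p = 0}"

definition ga_single :: "(nat \<Rightarrow> nat) \<Rightarrow> (nat \<Rightarrow> nat) \<Rightarrow> complex" where
  "ga_single g = (\<lambda>p. if p = g then 1 else 0)"

definition ga_mult ::
    "nat \<Rightarrow> ((nat \<Rightarrow> nat) \<Rightarrow> complex) \<Rightarrow> ((nat \<Rightarrow> nat) \<Rightarrow> complex) \<Rightarrow> (nat \<Rightarrow> nat) \<Rightarrow> complex" where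
  "ga_mult d x y =
    (\<lambda>p. \<Sum>(q, r)\<in>{(q, r). q \<in> Sym d \<and> r \<in> Sym d \<and> q \<circ> r = p}. x q * y r)"

text \<open>The standard tableau of shape \<open>\<nu>\<close> in which 1, 2, ... are written row by row.\<close>

definition tableau :: "nat list \<Rightarrow> nat \<times> nat \<Rightarrow> nat" where
  "tableau \<nu> c = sum_list (take (fst c) \<nu>) + snd c + 1"

definition row_entries :: "nat list \<Rightarrow> nat \<Rightarrow> nat set" where
  "row_entries \<nu> i = tableau \<nu> ` {c \<in> cells \<nu>. fst c = i}"

definition col_entries :: "nat list \<Rightarrow> nat \<Rightarrow> nat set" where
  "col_entries \<nu> j = tableau \<nu> ` {c \<in> cells \<nu>. snd c = j}"

definition row_group :: "nat \<Rightarrow> nat list \<Rightarrow> (nat \<Rightarrow> nat) set" where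
  "row_group d \<nu> = {p \<in> Sym d. \<forall>i. p ` row_entries \<nu> i = row_entries \<nu> i}"

definition col_group :: "nat \<Rightarrow> nat list \<Rightarrow> (nat \<Rightarrow> nat) set" where
  "col_group d \<nu> = {p \<in> Sym d. \<forall>j. p ` col_entries \<nu> j = col_entries \<nu> j}"

text \<open>The Young symmetrizer: the row symmetrizer times the signed column symmetrizer.
  The left ideal it generates is the irreducible representation (Specht module)
  indexed by \<open>\<nu>\<close>; the one-row diagram gives the trivial representation
  and the one-column diagram the sign representation.\<close>

definition young_symmetrizer :: "nat \<Rightarrow> nat list \<Rightarrow> (nat \<Rightarrow> nat) \<Rightarrow> complex" where
  "young_symmetrizer d \<nu> =
    ga_mult d (\<lambda>p. if p \<in> row_group d \<nu> then 1 else 0)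
              (\<lambda>q. if q \<in> col_group d \<nu> then of_int (sign q) else 0)"

definition irrep :: "nat \<Rightarrow> nat list \<Rightarrow> ((nat \<Rightarrow> nat) \<Rightarrow> complex) set" where
  "irrep d \<nu> = (\<lambda>x. ga_mult d x (young_symmetrizer d \<nu>)) ` group_algebra d"

definition dim_irrep :: "nat \<Rightarrow> nat list \<Rightarrow> nat" where
  "dim_irrep d \<nu> = cfun.dim (irrep d \<nu>)"

definition irrep_character :: "nat \<Rightarrow> nat list \<Rightarrow> (nat \<Rightarrow> nat) \<Rightarrow> complex" where
  "irrep_character d \<nu> g = trace_on (irrep d \<nu>) (ga_mult d (ga_single g))"

text \<open>The common value of the character on the conjugacy class of cycle type \<open>\<alpha>\<close>.\<close>

definition chi :: "nat \<Rightarrow> nat list \<Rightarrow> nat list \<Rightarrow> complex" where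
  "chi d \<alpha> \<nu> = irrep_character d \<nu> (SOME g. g \<in> conj_class d \<alpha>)"

definition omega :: "nat \<Rightarrow> nat list \<Rightarrow> nat list \<Rightarrow> complex" where
  "omega d \<alpha> \<nu> =
    of_nat (card (conj_class d \<alpha>)) * chi d \<alpha> \<nu> / of_nat (dim_irrep d \<nu>)"

definition plancherel_expectation :: "nat \<Rightarrow> (nat list \<Rightarrow> complex) \<Rightarrow> complex" where
  "plancherel_expectation d f =
    (\<Sum>\<nu>\<in>partitions_of d. f \<nu> * (of_nat (dim_irrep d \<nu>))\<^sup>2 / fact d)"


section \<open>Monotone walks\<close>

text \<open>The transposition \<open>(i j)\<close>, \<open>i < j\<close>, is encoded by the pair \<open>(i, j)\<close>,
  which it determines.\<close>

definition monotone_walks ::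
    "nat \<Rightarrow> nat \<Rightarrow> nat list \<Rightarrow> nat list \<Rightarrow> ((nat \<Rightarrow> nat) \<times> (nat \<times> nat) list) set" where
  "monotone_walks d r \<alpha> \<beta> =
    {(\<rho>, ts). \<rho> \<in> conj_class d \<alpha> \<and> length ts = r \<and>
       (\<forall>(i, j)\<in>set ts. 1 \<le> i \<and> i < j \<and> j \<le> d) \<and>
       sorted (map snd ts) \<and>
       \<rho> \<circ> foldr (\<circ>) (map (\<lambda>(i, j). transpose i j) ts) id \<in> conj_class d \<beta>}"

definition W :: "nat \<Rightarrow> nat \<Rightarrow> nat list \<Rightarrow> nat list \<Rightarrow> nat" where
  "W d r \<alpha> \<beta> = card (monotone_walks d r \<alpha> \<beta>)"

definition W_id :: "nat \<Rightarrow> nat \<Rightarrow> nat list \<Rightarrow> nat" where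
  "W_id d r \<beta> = W d r (replicate d 1) \<beta>"

end

theory Submission
  imports Defs
begin

text \<open>
  Work in the group algebra of the symmetric group. A central element \<open>z\<close> acts on the irreducible module
  of \<open>\<nu>\<close> by a scalar \<open>om z\<close>, and decomposing the regular representation gives
  \<open>\<langle>om z\<rangle> = z(id)\<close>. The class sum of \<open>\<alpha>\<close> acts by \<open>\<omega>\<^sub>\<alpha>\<close>, and the product of the factors \<open>1 + J\<^sub>k/N\<close> over
  the Jucys--Murphy elements \<open>J\<^sub>k\<close> acts by \<open>\<Omega>\<^sub>N\<close>. The inverse of that product expands into complete
  homogeneous polynomials in the \<open>-J\<^sub>k/N\<close>, whose coefficients count monotone sequences of
  transpositions; the expansion converges because \<open>J\<^sub>k\<close> has \<open>k - 1 < N\<close> terms.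

  Completeness of the Specht modules is obtained by counting: the symmetrized Young symmetrizers are
  orthogonal, hence independent, and their number, the number of partitions of \<open>d\<close>, is at least the
  number of conjugacy classes; so they span the center.
\<close>

text \<open>All information about a module is read off one coefficient. An element that is invariant
  under the row group on the left and alternating under the column group on the right is a multiple
  of the Young symmetrizer \<open>c\<close>, and \<open>c id = 1\<close>. So the scalar by which a
  central \<open>z\<close> acts is the coefficient of \<open>z \<star> c\<close> at
  \<open>id\<close>, a linear function of \<open>z\<close>. This takes the place of Schur's lemma
  and of an eigenbasis for the Jucys--Murphy elements. The obstacle is that a single Jucys--Murphy
  element is in general not central and need not act on \<open>c\<close> by a scalar; only the full
  product is central. Moved between the row symmetrizer and the column antisymmetrizer, it is
  evaluated one factor at a time on the tableau restricted to the entries up to k. Row-by-row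
  numbering makes each restriction a Young diagram, and the last element contributes the content of
  the cell of k: one for each entry to its left, minus one for each entry above it. Hence
  \<open>stab\<close>, \<open>symr\<close> and \<open>altr\<close> carry a cutoff
  \<open>k\<close>.\<close>

lemma sum_apply_fun: "(\<Sum>i\<in>I. f i) x = (\<Sum>i\<in>I. f i x)"
  for f :: "'i \<Rightarrow> 'a \<Rightarrow> 'b::comm_monoid_add"
  by (induction I rule: infinite_finite_induct) auto

lemma scale_fun_apply [simp]: "scale_fun c f x = c * f x"
  by (simp add: scale_fun_def)

section \<open>The group algebra\<close>

locale sym_algebra =
  fixes d :: nat
begin

abbreviation G where "G \<equiv> Sym d"
abbreviation A where "A \<equiv> group_algebra d"
abbreviation mul (infixl "\<star>" 70) where "x \<star> y \<equiv> ga_mult d x y"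
abbreviation scl (infixr "\<cdot>" 75) where "c \<cdot> x \<equiv> scale_fun c x"
abbreviation \<delta> :: "(nat \<Rightarrow> nat) \<Rightarrow> (nat \<Rightarrow> nat) \<Rightarrow> complex" where "\<delta> \<equiv> ga_single"

lemma finite_G [simp]: "finite G"
  by (simp add: Sym_def finite_permutations)

lemma id_G [simp]: "id \<in> G"
  by (simp add: Sym_def permutes_id)

lemma comp_G [simp]: "p \<in> G \<Longrightarrow> q \<in> G \<Longrightarrow> p \<circ> q \<in> G"
  by (simp add: Sym_def permutes_compose)

lemma inv_G [simp]: "p \<in> G \<Longrightarrow> inv p \<in> G"
  by (simp add: Sym_def permutes_inv)

lemma G_bij: "p \<in> G \<Longrightarrow> bij p"
  by (auto simp: Sym_def permutes_bij)

lemma G_inv_o [simp]: "p \<in> G \<Longrightarrow> inv p \<circ> p = id" "p \<in> G \<Longrightarrow> p \<circ> inv p = id"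
  by (auto simp: Sym_def permutes_inv_o)

lemma G_inv_app [simp]: "p \<in> G \<Longrightarrow> inv p (p x) = x" "p \<in> G \<Longrightarrow> p (inv p x) = x"
  by (auto simp: Sym_def permutes_inverses)

lemma G_inv_inv [simp]: "p \<in> G \<Longrightarrow> inv (inv p) = p"
  by (simp add: G_bij inv_inv_eq)

lemma G_inv_comp: "p \<in> G \<Longrightarrow> q \<in> G \<Longrightarrow> inv (p \<circ> q) = inv q \<circ> inv p"
  by (simp add: G_bij o_inv_distrib)

lemma G_cancel [simp]:
  "p \<in> G \<Longrightarrow> inv p \<circ> (p \<circ> q) = q" "p \<in> G \<Longrightarrow> p \<circ> (inv p \<circ> q) = q"
  "p \<in> G \<Longrightarrow> (q \<circ> inv p) \<circ> p = q" "p \<in> G \<Longrightarrow> (q \<circ> p) \<circ> inv p = q"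
  by (auto simp: fun_eq_iff)

lemma G_range [simp]: "p \<in> G \<Longrightarrow> p x \<in> {1..d} \<longleftrightarrow> x \<in> {1..d}"
  by (simp only: Sym_def mem_Collect_eq permutes_in_image)

lemma bij_betw_comp_left: "p \<in> G \<Longrightarrow> bij_betw (\<lambda>q. p \<circ> q) G G"
  by (rule bij_betwI[where g = "\<lambda>q. inv p \<circ> q"]) auto

lemma bij_betw_comp_right: "p \<in> G \<Longrightarrow> bij_betw (\<lambda>q. q \<circ> p) G G"
  by (rule bij_betwI[where g = "\<lambda>q. q \<circ> inv p"]) auto

lemma bij_betw_inv_G: "bij_betw inv G G"
  by (rule bij_betwI[where g = inv]) auto

lemma sum_comp_left: "p \<in> G \<Longrightarrow> (\<Sum>q\<in>G. f (p \<circ> q)) = (\<Sum>q\<in>G. f q)"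
  by (rule sum.reindex_bij_betw[OF bij_betw_comp_left])

lemma sum_comp_right: "p \<in> G \<Longrightarrow> (\<Sum>q\<in>G. f (q \<circ> p)) = (\<Sum>q\<in>G. f q)"
  by (rule sum.reindex_bij_betw[OF bij_betw_comp_right])

lemma sum_inv_G: "(\<Sum>q\<in>G. f (inv q)) = (\<Sum>q\<in>G. f q)"
  by (rule sum.reindex_bij_betw[OF bij_betw_inv_G])

text \<open>In a pair with \<open>q \<circ> r = p\<close> the factor \<open>r\<close> is determined
  by \<open>q\<close>. Off \<open>G\<close> the product is 0 whatever \<open>x\<close> and
  \<open>y\<close> are, so many of the algebra laws below hold for arbitrary functions.\<close>

lemma ga_mult_eq: "(x \<star> y) p = (if p \<in> G then \<Sum>q\<in>G. x q * y (inv q \<circ> p) else 0)"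
proof (cases "p \<in> G")
  case True
  have eq: "{(q, r). q \<in> G \<and> r \<in> G \<and> q \<circ> r = p} = (\<lambda>q. (q, inv q \<circ> p)) ` G"
    using True by auto
  have "(x \<star> y) p = (\<Sum>z\<in>(\<lambda>q. (q, inv q \<circ> p)) ` G. case z of (q, r) \<Rightarrow> x q * y r)"
    unfolding ga_mult_def eq ..
  also have "\<dots> = (\<Sum>q\<in>G. x q * y (inv q \<circ> p))"
    by (subst sum.reindex) (auto simp: inj_on_def)
  finally show ?thesis using True by simp
next
  case False
  then have eq: "{(q, r). q \<in> G \<and> r \<in> G \<and> q \<circ> r = p} = {}" by auto
  show ?thesis using False unfolding ga_mult_def eq by simp
qed

lemma ga_mult_eq': "p \<in> G \<Longrightarrow> (x \<star> y) p = (\<Sum>r\<in>G. x (p \<circ> inv r) * y r)"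
  unfolding ga_mult_eq
  by (subst sum_inv_G[symmetric], subst sum_comp_right[symmetric, of "inv p"])
     (auto intro!: sum.cong simp: G_inv_comp)

lemma mul_A [simp]: "x \<star> y \<in> A"
  by (simp add: group_algebra_def ga_mult_eq)

lemma \<delta>_A [simp]: "g \<in> G \<Longrightarrow> \<delta> g \<in> A"
  by (auto simp: group_algebra_def ga_single_def)

lemma A_subspace: "cfun.subspace A"
  by (auto simp: cfun.subspace_def group_algebra_def)

lemma A_closed [simp]:
  "x \<in> A \<Longrightarrow> y \<in> A \<Longrightarrow> x + y \<in> A" "x \<in> A \<Longrightarrow> y \<in> A \<Longrightarrow> x - y \<in> A" "x \<in> A \<Longrightarrow> c \<cdot> x \<in> A" "0 \<in> A"
  using A_subspace by (auto intro: cfun.subspace_add cfun.subspace_diff cfun.subspace_scale cfun.subspace_0)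

lemma A_sum [simp]: "(\<And>i. i \<in> I \<Longrightarrow> f i \<in> A) \<Longrightarrow> sum f I \<in> A"
  by (rule cfun.subspace_sum[OF A_subspace])

lemma A_eqI: "x \<in> A \<Longrightarrow> y \<in> A \<Longrightarrow> (\<And>p. p \<in> G \<Longrightarrow> x p = y p) \<Longrightarrow> x = y"
  by (force simp: group_algebra_def fun_eq_iff)

lemma A_outside: "x \<in> A \<Longrightarrow> p \<notin> G \<Longrightarrow> x p = 0"
  by (auto simp: group_algebra_def)

lemma mul_add_left: "(x + y) \<star> z = x \<star> z + y \<star> z"
  and mul_add_right: "z \<star> (x + y) = z \<star> x + z \<star> y"
  and mul_diff_left: "(x - y) \<star> z = x \<star> z - y \<star> z"
  and mul_diff_right: "z \<star> (x - y) = z \<star> x - z \<star> y"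
  and mul_scale_left [simp]: "(c \<cdot> x) \<star> z = c \<cdot> (x \<star> z)"
  and mul_scale_right [simp]: "z \<star> (c \<cdot> x) = c \<cdot> (z \<star> x)"
  and mul_zero_left [simp]: "0 \<star> z = 0"
  and mul_zero_right [simp]: "z \<star> 0 = 0"
  by (rule ext, simp add: ga_mult_eq algebra_simps sum.distrib sum_subtractf sum_distrib_left)+

lemma mul_sum_left:
  fixes f :: "'i \<Rightarrow> (nat \<Rightarrow> nat) \<Rightarrow> complex"
  shows "(\<Sum>i\<in>I. f i) \<star> z = (\<Sum>i\<in>I. f i \<star> z)"
  by (induction I rule: infinite_finite_induct) (simp_all add: mul_add_left del: plus_fun_apply zero_fun_apply)

lemma mul_sum_right:
  fixes f :: "'i \<Rightarrow> (nat \<Rightarrow> nat) \<Rightarrow> complex"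
  shows "z \<star> (\<Sum>i\<in>I. f i) = (\<Sum>i\<in>I. z \<star> f i)"
  by (induction I rule: infinite_finite_induct) (simp_all add: mul_add_right del: plus_fun_apply zero_fun_apply)

lemma mul_assoc: "(x \<star> y) \<star> z = x \<star> (y \<star> z)"
proof (rule A_eqI)
  fix p assume p: "p \<in> G"
  have "((x \<star> y) \<star> z) p = (\<Sum>r\<in>G. (\<Sum>q\<in>G. x q * y (inv q \<circ> (p \<circ> inv r))) * z r)"
    using p by (subst ga_mult_eq') (auto simp: ga_mult_eq)
  also have "\<dots> = (\<Sum>q\<in>G. x q * (\<Sum>r\<in>G. y (inv q \<circ> p \<circ> inv r) * z r))"
    unfolding sum_distrib_left sum_distrib_right
    by (subst sum.swap) (simp add: o_assoc mult.assoc)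
  also have "\<dots> = (x \<star> (y \<star> z)) p"
    using p by (subst ga_mult_eq) (auto simp: ga_mult_eq' intro!: sum.cong)
  finally show "((x \<star> y) \<star> z) p = (x \<star> (y \<star> z)) p" .
qed auto

lemma \<delta>_app: "\<delta> g p = (if p = g then 1 else 0)"
  by (simp add: ga_single_def)

lemma \<delta>_mul_app: "g \<in> G \<Longrightarrow> p \<in> G \<Longrightarrow> (\<delta> g \<star> x) p = x (inv g \<circ> p)"
  by (simp add: ga_mult_eq \<delta>_app if_distrib[of "\<lambda>u. u * _"] sum.delta cong: if_cong)

lemma mul_\<delta>_app: "g \<in> G \<Longrightarrow> p \<in> G \<Longrightarrow> (x \<star> \<delta> g) p = x (p \<circ> inv g)"
  by (simp add: ga_mult_eq' \<delta>_app if_distrib[of "\<lambda>u. _ * u"] sum.delta cong: if_cong)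

lemma \<delta>_mul_\<delta>: "g \<in> G \<Longrightarrow> h \<in> G \<Longrightarrow> \<delta> g \<star> \<delta> h = \<delta> (g \<circ> h)"
  by (rule A_eqI) (auto simp: \<delta>_mul_app \<delta>_app)

lemma one_mul [simp]: "x \<in> A \<Longrightarrow> \<delta> id \<star> x = x"
  by (rule A_eqI) (auto simp: \<delta>_mul_app inv_id)

lemma mul_one [simp]: "x \<in> A \<Longrightarrow> x \<star> \<delta> id = x"
  by (rule A_eqI) (auto simp: mul_\<delta>_app inv_id)

lemma A_expand: "x \<in> A \<Longrightarrow> x = (\<Sum>g\<in>G. x g \<cdot> \<delta> g)"
  by (rule A_eqI) (auto simp: sum_apply_fun \<delta>_app sum.delta' if_distrib[of "\<lambda>u. _ * u"] cong: if_cong)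

lemma conj_app: "g \<in> G \<Longrightarrow> p \<in> G \<Longrightarrow> (\<delta> g \<star> x \<star> \<delta> (inv g)) p = x (inv g \<circ> p \<circ> g)"
  by (simp add: mul_\<delta>_app \<delta>_mul_app o_assoc)

definition central :: "((nat \<Rightarrow> nat) \<Rightarrow> complex) \<Rightarrow> bool" where
  "central x \<longleftrightarrow> x \<in> A \<and> (\<forall>g\<in>G. \<delta> g \<star> x = x \<star> \<delta> g)"

lemma central_A: "central x \<Longrightarrow> x \<in> A"
  by (simp add: central_def)

lemma central_commute:
  assumes x: "central x" and y: "y \<in> A"
  shows "x \<star> y = y \<star> x"
proof -
  have "x \<star> y = (\<Sum>g\<in>G. y g \<cdot> (x \<star> \<delta> g))"
    by (subst A_expand[OF y]) (simp add: mul_sum_right)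
  also have "\<dots> = (\<Sum>g\<in>G. y g \<cdot> (\<delta> g \<star> x))"
    using x by (auto simp: central_def intro!: sum.cong)
  also have "\<dots> = y \<star> x"
    by (subst (2) A_expand[OF y]) (simp add: mul_sum_left)
  finally show ?thesis .
qed

lemma centralI_commute: "x \<in> A \<Longrightarrow> (\<And>y. y \<in> A \<Longrightarrow> x \<star> y = y \<star> x) \<Longrightarrow> central x"
  by (simp add: central_def)

lemma central_mul:
  assumes "central x" "central y" shows "central (x \<star> y)"
  by (rule centralI_commute) (use assms central_commute mul_assoc central_A mul_A in metis)+

lemma central_app:
  assumes "central x" "g \<in> G" "p \<in> G"
  shows "x (g \<circ> p \<circ> inv g) = x p"
proof -
  have "\<delta> (inv g) \<star> x = x \<star> \<delta> (inv g)" using assms by (simp add: central_def)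
  then have "(\<delta> (inv g) \<star> x) (p \<circ> inv g) = (x \<star> \<delta> (inv g)) (p \<circ> inv g)" by simp
  then show ?thesis using assms by (simp add: \<delta>_mul_app mul_\<delta>_app o_assoc)
qed

lemma centralI_app:
  assumes "x \<in> A" "\<And>g p. g \<in> G \<Longrightarrow> p \<in> G \<Longrightarrow> x (g \<circ> p \<circ> inv g) = x p"
  shows "central x"
  unfolding central_def
proof (intro conjI ballI A_eqI)
  fix g p assume "g \<in> G" "p \<in> G"
  then show "(\<delta> g \<star> x) p = (x \<star> \<delta> g) p"
    using assms(2)[of g "inv g \<circ> p"] by (simp add: \<delta>_mul_app mul_\<delta>_app)
qed (use assms in auto)

end

text \<open>As simp rules, the pointwise laws for functions let the simplifier eta-expand elements of the
  group algebra, after which the algebra laws no longer apply.\<close>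

declare One_nat_def [simp del] plus_fun_apply [simp del] zero_fun_apply [simp del]

section \<open>Young subgroups given by a labelling\<close>

text \<open>For \<open>f\<close> the row or column of an entry and \<open>k = d\<close> this is the
  row or column group of the tableau; smaller \<open>k\<close> gives the groups of the tableau
  restricted to the entries up to \<open>k\<close>.\<close>

definition stab :: "nat \<Rightarrow> (nat \<Rightarrow> nat) \<Rightarrow> (nat \<Rightarrow> nat) set" where
  "stab k f = {p. p permutes {1..k} \<and> (\<forall>x\<in>{1..k}. f (p x) = f x)}"

lemma stab_permutes: "p \<in> stab k f \<Longrightarrow> p permutes {1..k}"
  by (simp add: stab_def)

lemma stab_app: "p \<in> stab k f \<Longrightarrow> f (p x) = f x"
  by (cases "x \<in> {1..k}") (auto simp: stab_def permutes_not_in)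

lemma stabI: "p permutes {1..k} \<Longrightarrow> (\<And>x. x \<in> {1..k} \<Longrightarrow> f (p x) = f x) \<Longrightarrow> p \<in> stab k f"
  by (simp add: stab_def)

lemma finite_stab [simp]: "finite (stab k f)"
  by (rule finite_subset[of _ "{p. p permutes {1..k}}"]) (auto simp: stab_def finite_permutations)

lemma id_stab [simp]: "id \<in> stab k f"
  by (simp add: stab_def permutes_id)

lemma comp_stab: "p \<in> stab k f \<Longrightarrow> q \<in> stab k f \<Longrightarrow> p \<circ> q \<in> stab k f"
  by (intro stabI permutes_compose) (auto simp: stab_app stab_permutes)

lemma inv_stab:
  assumes "p \<in> stab k f" shows "inv p \<in> stab k f"
proof (rule stabI)
  fix x
  show "f (inv p x) = f x"
    using stab_app[OF assms, of "inv p x"] stab_permutes[OF assms] by (simp add: permutes_inverses)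
qed (use assms in \<open>auto simp: stab_permutes permutes_inv\<close>)

lemma transpose_stab: "x \<in> {1..k} \<Longrightarrow> y \<in> {1..k} \<Longrightarrow> f x = f y \<Longrightarrow> transpose x y \<in> stab k f"
  by (intro stabI permutes_swap_id) (auto simp: transpose_def)

lemma stab_const: "stab k (\<lambda>_. c) = {p. p permutes {1..k}}"
  by (auto simp: stab_def)

text \<open>Coset decomposition: \<open>m\<close> is the image of \<open>Suc k\<close>, which must
  carry the label of \<open>Suc k\<close>, and composing with the transposition leaves a permutation
  that fixes \<open>Suc k\<close>.\<close>

lemma bij_betw_stab_Suc:
  "bij_betw (\<lambda>(m, q). transpose m (Suc k) \<circ> q) ({m \<in> {1..Suc k}. f m = f (Suc k)} \<times> stab k f) (stab (Suc k) f)"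
proof (rule bij_betwI[where g = "\<lambda>p. (p (Suc k), transpose (p (Suc k)) (Suc k) \<circ> p)"])
  have sub: "q \<in> stab k f \<Longrightarrow> q \<in> stab (Suc k) f" for q
    using permutes_subset[of q "{1..k}" "{1..Suc k}"] by (intro stabI) (auto simp: stab_permutes stab_app)
  show "(\<lambda>(m, q). transpose m (Suc k) \<circ> q) \<in> {m \<in> {1..Suc k}. f m = f (Suc k)} \<times> stab k f \<rightarrow> stab (Suc k) f"
  proof safe
    fix m q assume m: "m \<in> {1..Suc k}" "f m = f (Suc k)" and q: "q \<in> stab k f"
    have "transpose m (Suc k) \<in> stab (Suc k) f" by (rule transpose_stab) (use m in auto)
    then show "transpose m (Suc k) \<circ> q \<in> stab (Suc k) f" using sub[OF q] by (rule comp_stab)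
  qed
  show "(\<lambda>p. (p (Suc k), transpose (p (Suc k)) (Suc k) \<circ> p))
     \<in> stab (Suc k) f \<rightarrow> {m \<in> {1..Suc k}. f m = f (Suc k)} \<times> stab k f"
  proof safe
    fix p assume p: "p \<in> stab (Suc k) f"
    have in1: "p (Suc k) \<in> {1..Suc k}"
      using permutes_in_image[OF stab_permutes[OF p], of "Suc k"] by auto
    then show "p (Suc k) \<in> {1..Suc k}" .
    show feq: "f (p (Suc k)) = f (Suc k)" by (rule stab_app[OF p])
    let ?q = "transpose (p (Suc k)) (Suc k) \<circ> p"
    have q: "?q \<in> stab (Suc k) f"
      using in1 feq p by (intro comp_stab transpose_stab) auto
    \<comment> \<open>The transposition returns \<open>p (Suc k)\<close> to \<open>Suc k\<close>, so
      \<open>?q\<close> fixes \<open>Suc k\<close>.\<close>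
    have "?q permutes {1..k}"
      by (rule permutes_superset[OF stab_permutes[OF q]]) (auto simp: le_Suc_eq)
    then show "?q \<in> stab k f" using stab_app[OF q] by (intro stabI)
  qed
next
  fix x assume "x \<in> {m \<in> {1..Suc k}. f m = f (Suc k)} \<times> stab k f"
  then obtain m q where x: "x = (m, q)" "q \<in> stab k f" by auto
  have "q (Suc k) = Suc k" using stab_permutes[OF x(2)] by (auto intro: permutes_not_in)
  then show "((case x of (m, q) \<Rightarrow> transpose m (Suc k) \<circ> q) (Suc k), transpose ((case x of (m, q) \<Rightarrow> transpose m (Suc k) \<circ> q) (Suc k)) (Suc k) \<circ> (case x of (m, q) \<Rightarrow> transpose m (Suc k) \<circ> q)) = x"
    by (simp add: x fun_eq_iff)
qed (auto simp: fun_eq_iff)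

lemma bij_betw_inv_stab: "bij_betw inv (stab k f) (stab k f)"
  by (rule bij_betwI[where g = inv])
     (auto simp: inv_stab permutes_inv_inv dest: stab_permutes)

lemma sum_stab_Suc:
  "(\<Sum>p\<in>stab (Suc k) f. F p) = (\<Sum>m | m \<in> {1..Suc k} \<and> f m = f (Suc k). \<Sum>q\<in>stab k f. F (transpose m (Suc k) \<circ> q))"
  by (subst sum.reindex_bij_betw[OF bij_betw_stab_Suc, symmetric])
     (simp add: sum.cartesian_product case_prod_unfold)

text \<open>The same decomposition with the transposition on the other side, obtained by inverting.
  Antisymmetrizers stand on the right of the Young symmetrizer, so their new factor has to split off
  on the right.\<close>

lemma sum_stab_Suc':
  "(\<Sum>p\<in>stab (Suc k) f. F p) = (\<Sum>m | m \<in> {1..Suc k} \<and> f m = f (Suc k). \<Sum>q\<in>stab k f. F (q \<circ> transpose m (Suc k)))"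
proof -
  have "(\<Sum>p\<in>stab (Suc k) f. F p) = (\<Sum>p\<in>stab (Suc k) f. F (inv p))"
    by (subst sum.reindex_bij_betw[OF bij_betw_inv_stab]) simp
  also have "\<dots> = (\<Sum>m | m \<in> {1..Suc k} \<and> f m = f (Suc k). \<Sum>q\<in>stab k f. F (inv q \<circ> transpose m (Suc k)))"
    unfolding sum_stab_Suc
    by (intro sum.cong refl) (simp add: o_inv_distrib permutes_bij[OF stab_permutes])
  also have "\<dots> = (\<Sum>m | m \<in> {1..Suc k} \<and> f m = f (Suc k). \<Sum>q\<in>stab k f. F (q \<circ> transpose m (Suc k)))"
  proof (rule sum.cong[OF refl])
    fix m
    show "(\<Sum>q\<in>stab k f. F (inv q \<circ> transpose m (Suc k))) = (\<Sum>q\<in>stab k f. F (q \<circ> transpose m (Suc k)))"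
      by (rule sum.reindex_bij_betw[OF bij_betw_inv_stab])
  qed
  finally show ?thesis .
qed

section \<open>Symmetrizers and antisymmetrizers\<close>

context sym_algebra
begin

lemma permutes_G: "p permutes {1..k} \<Longrightarrow> k \<le> d \<Longrightarrow> p \<in> G"
  unfolding Sym_def using permutes_subset[of p "{1..k}" "{1..d}"] by auto

lemma stab_G: "p \<in> stab k f \<Longrightarrow> k \<le> d \<Longrightarrow> p \<in> G"
  using permutes_G stab_permutes by blast

lemma transpose_G [simp]: "x \<in> {1..d} \<Longrightarrow> y \<in> {1..d} \<Longrightarrow> transpose x y \<in> G"
  unfolding Sym_def by (auto intro: permutes_swap_id)

lemma G_comp_transpose: "g \<in> G \<Longrightarrow> g \<circ> transpose a b = transpose (g a) (g b) \<circ> g"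
  using bij_is_inj[OF G_bij[of g]] by (auto simp: fun_eq_iff transpose_def inj_eq)

lemma G_permutation: "p \<in> G \<Longrightarrow> permutation p"
  unfolding Sym_def by (auto intro: permutes_imp_permutation)

lemma sign_comp_G: "p \<in> G \<Longrightarrow> q \<in> G \<Longrightarrow> sign (p \<circ> q) = sign p * sign q"
  by (simp add: sign_compose G_permutation)

lemma of_int_sign_sq [simp]: "of_int (sign p) * of_int (sign p) = (1::complex)"
    "of_int (sign p) * (of_int (sign p) * z) = (z::complex)"
  unfolding mult.assoc[symmetric] by (simp_all flip: of_int_mult)

definition symr :: "nat \<Rightarrow> (nat \<Rightarrow> nat) \<Rightarrow> (nat \<Rightarrow> nat) \<Rightarrow> complex" where
  "symr k f = (\<Sum>p\<in>stab k f. \<delta> p)"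

definition altr :: "nat \<Rightarrow> (nat \<Rightarrow> nat) \<Rightarrow> (nat \<Rightarrow> nat) \<Rightarrow> complex" where
  "altr k f = (\<Sum>p\<in>stab k f. of_int (sign p) \<cdot> \<delta> p)"

lemma symr_A [simp]: "k \<le> d \<Longrightarrow> symr k f \<in> A"
  unfolding symr_def by (intro A_sum \<delta>_A stab_G)

lemma altr_A [simp]: "k \<le> d \<Longrightarrow> altr k f \<in> A"
  unfolding altr_def by (intro A_sum A_closed(3) \<delta>_A stab_G)

lemma symr_app: "symr k f p = (if p \<in> stab k f then 1 else 0)"
  unfolding symr_def sum_apply_fun \<delta>_app by (simp add: sum.delta')

lemma altr_app: "altr k f p = (if p \<in> stab k f then of_int (sign p) else 0)"
  unfolding altr_def sum_apply_fun scale_fun_apply \<delta>_app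
  by (simp add: if_distrib[of "\<lambda>u. _ * u"] sum.delta' cong: if_cong)

lemma bij_betw_stab_comp:
  assumes "p \<in> stab k f"
  shows "bij_betw (\<lambda>q. p \<circ> q) (stab k f) (stab k f)" "bij_betw (\<lambda>q. q \<circ> p) (stab k f) (stab k f)"
proof -
  have p: "p permutes {1..k}" using assms by (rule stab_permutes)
  show "bij_betw (\<lambda>q. p \<circ> q) (stab k f) (stab k f)"
    by (rule bij_betwI[where g = "\<lambda>q. inv p \<circ> q"])
       (use assms in \<open>auto simp: comp_stab inv_stab o_assoc permutes_inv_o[OF p]\<close>)
  show "bij_betw (\<lambda>q. q \<circ> p) (stab k f) (stab k f)"
    by (rule bij_betwI[where g = "\<lambda>q. q \<circ> inv p"])
       (use assms in \<open>auto simp: comp_stab inv_stab o_assoc[symmetric] permutes_inv_o[OF p]\<close>)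
qed

lemma \<delta>_symr:
  assumes "k \<le> d" "p \<in> stab k f"
  shows "\<delta> p \<star> symr k f = symr k f"
proof -
  have "\<delta> p \<star> symr k f = (\<Sum>q\<in>stab k f. \<delta> (p \<circ> q))"
    unfolding symr_def mul_sum_right
    by (intro sum.cong refl) (simp add: \<delta>_mul_\<delta> stab_G[of _ k f, OF _ assms(1)] assms(2))
  also have "\<dots> = symr k f"
    unfolding symr_def by (rule sum.reindex_bij_betw[OF bij_betw_stab_comp(1)[OF assms(2)]])
  finally show ?thesis .
qed

lemma symr_\<delta>:
  assumes "k \<le> d" "p \<in> stab k f"
  shows "symr k f \<star> \<delta> p = symr k f"
proof -
  have "symr k f \<star> \<delta> p = (\<Sum>q\<in>stab k f. \<delta> (q \<circ> p))"
    unfolding symr_def mul_sum_left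
    by (intro sum.cong refl) (simp add: \<delta>_mul_\<delta> stab_G[of _ k f, OF _ assms(1)] assms(2))
  also have "\<dots> = symr k f"
    unfolding symr_def by (rule sum.reindex_bij_betw[OF bij_betw_stab_comp(2)[OF assms(2)]])
  finally show ?thesis .
qed

lemma \<delta>_altr:
  assumes "k \<le> d" "p \<in> stab k f"
  shows "\<delta> p \<star> altr k f = of_int (sign p) \<cdot> altr k f"
proof -
  have "\<delta> p \<star> altr k f = (\<Sum>q\<in>stab k f. of_int (sign p) \<cdot> (of_int (sign (p \<circ> q)) \<cdot> \<delta> (p \<circ> q)))"
    unfolding altr_def mul_sum_right
    by (intro sum.cong refl) (simp add: \<delta>_mul_\<delta> sign_comp_G stab_G[of _ k f, OF _ assms(1)] assms(2))
  also have "\<dots> = of_int (sign p) \<cdot> (\<Sum>q\<in>stab k f. of_int (sign (p \<circ> q)) \<cdot> \<delta> (p \<circ> q))"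
    by (simp only: cfun.scale_sum_right)
  also have "(\<Sum>q\<in>stab k f. of_int (sign (p \<circ> q)) \<cdot> \<delta> (p \<circ> q)) = altr k f"
    unfolding altr_def by (rule sum.reindex_bij_betw[OF bij_betw_stab_comp(1)[OF assms(2)]])
  finally show ?thesis .
qed

lemma altr_\<delta>:
  assumes "k \<le> d" "p \<in> stab k f"
  shows "altr k f \<star> \<delta> p = of_int (sign p) \<cdot> altr k f"
proof -
  have "altr k f \<star> \<delta> p = (\<Sum>q\<in>stab k f. of_int (sign p) \<cdot> (of_int (sign (q \<circ> p)) \<cdot> \<delta> (q \<circ> p)))"
    unfolding altr_def mul_sum_left
    by (intro sum.cong refl) (simp add: \<delta>_mul_\<delta> sign_comp_G stab_G[of _ k f, OF _ assms(1)] assms(2) mult.commute)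
  also have "\<dots> = of_int (sign p) \<cdot> (\<Sum>q\<in>stab k f. of_int (sign (q \<circ> p)) \<cdot> \<delta> (q \<circ> p))"
    by (simp only: cfun.scale_sum_right)
  also have "(\<Sum>q\<in>stab k f. of_int (sign (q \<circ> p)) \<cdot> \<delta> (q \<circ> p)) = altr k f"
    unfolding altr_def by (rule sum.reindex_bij_betw[OF bij_betw_stab_comp(2)[OF assms(2)]])
  finally show ?thesis .
qed

text \<open>The new factor goes to the outside, on the left here and on the right in
  \<open>altr_Suc\<close>, so that in a product \<open>symr \<star> u \<star> altr\<close> the
  smaller symmetrizers remain next to \<open>u\<close>.\<close>

lemma symr_Suc:
  assumes "Suc k \<le> d"
  shows "symr (Suc k) f = (\<Sum>m | m \<in> {1..Suc k} \<and> f m = f (Suc k). \<delta> (transpose m (Suc k))) \<star> symr k f"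
  unfolding symr_def mul_sum_left mul_sum_right sum_stab_Suc
  by (subst sum.swap, intro sum.cong refl) (use assms in \<open>auto simp: \<delta>_mul_\<delta> stab_G[of _ k f]\<close>)

lemma altr_Suc:
  assumes "Suc k \<le> d"
  shows "altr (Suc k) f = altr k f \<star> (\<Sum>m | m \<in> {1..Suc k} \<and> f m = f (Suc k). of_int (sign (transpose m (Suc k))) \<cdot> \<delta> (transpose m (Suc k)))"
  unfolding altr_def mul_sum_left mul_sum_right sum_stab_Suc'
  by (intro sum.cong refl)
     (use assms in \<open>auto simp: \<delta>_mul_\<delta> stab_G[of _ k f] sign_comp_G mult.commute\<close>)

section \<open>Jucys--Murphy elements\<close>

text \<open>The index is the larger entry of the transposition, hence the quantity that is weakly
  increasing along a monotone walk.\<close>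

definition JM :: "nat \<Rightarrow> (nat \<Rightarrow> nat) \<Rightarrow> complex" where
  "JM k = (\<Sum>m\<in>{1..<k}. \<delta> (transpose m k))"

text \<open>The group algebra of the permutations of \<open>{1..k}\<close>, viewed inside
  \<open>A\<close>.\<close>

definition supp :: "nat \<Rightarrow> ((nat \<Rightarrow> nat) \<Rightarrow> complex) \<Rightarrow> bool" where
  "supp k x \<longleftrightarrow> x \<in> A \<and> (\<forall>p. x p \<noteq> 0 \<longrightarrow> p permutes {1..k})"

lemma JM_A [simp]: "k \<le> d \<Longrightarrow> JM k \<in> A"
  unfolding JM_def by (intro A_sum \<delta>_A transpose_G) auto

text \<open>\<open>g\<close> fixes \<open>Suc k\<close> and permutes \<open>{1..k}\<close>, so
  conjugation by \<open>g\<close> only permutes the summands of \<open>JM (Suc k)\<close>.\<close>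

lemma \<delta>_JM_commute:
  assumes "g permutes {1..k}" "Suc k \<le> d"
  shows "\<delta> g \<star> JM (Suc k) = JM (Suc k) \<star> \<delta> g"
proof -
  have g: "g \<in> G" using assms permutes_G[of g k] by auto
  have bij: "bij_betw g {1..<Suc k} {1..<Suc k}"
    using permutes_imp_bij[OF assms(1)] by (simp add: atLeastLessThanSuc_atLeastAtMost)
  have eq: "g \<circ> transpose m (Suc k) = transpose (g m) (Suc k) \<circ> g" for m
    using G_comp_transpose[OF g, of m "Suc k"] permutes_not_in[OF assms(1), of "Suc k"] by simp
  have "\<delta> g \<star> JM (Suc k) = (\<Sum>m\<in>{1..<Suc k}. \<delta> (transpose (g m) (Suc k) \<circ> g))"
    unfolding JM_def mul_sum_right
    by (intro sum.cong refl) (use assms g in \<open>auto simp: \<delta>_mul_\<delta> eq\<close>)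
  also have "\<dots> = (\<Sum>m\<in>{1..<Suc k}. \<delta> (transpose m (Suc k) \<circ> g))"
    by (rule sum.reindex_bij_betw[OF bij])
  also have "\<dots> = JM (Suc k) \<star> \<delta> g"
    unfolding JM_def mul_sum_left
    by (intro sum.cong refl) (use assms g in \<open>auto simp: \<delta>_mul_\<delta>\<close>)
  finally show ?thesis .
qed

lemma supp_commute:
  assumes x: "supp k x" and y: "\<And>g. g permutes {1..k} \<Longrightarrow> \<delta> g \<star> y = y \<star> \<delta> g"
  shows "x \<star> y = y \<star> x"
proof -
  have xA: "x \<in> A" using x by (simp add: supp_def)
  have "x \<star> y = (\<Sum>g\<in>G. x g \<cdot> (\<delta> g \<star> y))"
    by (subst A_expand[OF xA]) (simp add: mul_sum_left)
  also have "\<dots> = (\<Sum>g\<in>G. x g \<cdot> (y \<star> \<delta> g))"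
  proof (intro sum.cong refl)
    fix g show "x g \<cdot> (\<delta> g \<star> y) = x g \<cdot> (y \<star> \<delta> g)"
      using x y[of g] by (cases "x g = 0") (auto simp: supp_def)
  qed
  also have "\<dots> = y \<star> x"
    by (subst (2) A_expand[OF xA]) (simp add: mul_sum_right)
  finally show ?thesis .
qed

lemma supp_mono: "supp k x \<Longrightarrow> k \<le> l \<Longrightarrow> supp l x"
  using permutes_subset[of _ "{1..k}" "{1..l}"] by (auto simp: supp_def)

lemma supp_\<delta>: "g permutes {1..k} \<Longrightarrow> k \<le> d \<Longrightarrow> supp k (\<delta> g)"
  by (auto simp: supp_def \<delta>_app permutes_G split: if_splits)

lemma supp_add: "supp k x \<Longrightarrow> supp k y \<Longrightarrow> supp k (x + y)"
  by (auto simp: supp_def plus_fun_apply) (metis add.right_neutral)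

lemma supp_scale: "supp k x \<Longrightarrow> supp k (c \<cdot> x)"
  by (auto simp: supp_def)

lemma supp_zero: "supp k 0"
  by (auto simp: supp_def zero_fun_apply)

lemma supp_sum: "(\<And>i. i \<in> I \<Longrightarrow> supp k (F i)) \<Longrightarrow> supp k (sum F I)"
  by (induction I rule: infinite_finite_induct) (auto simp: supp_zero supp_add)

lemma supp_mul:
  assumes x: "supp k x" and y: "supp k y"
  shows "supp k (x \<star> y)"
  unfolding supp_def
proof (intro conjI allI impI mul_A)
  fix p assume "(x \<star> y) p \<noteq> 0"
  then obtain q where q: "p \<in> G" "q \<in> G" "x q \<noteq> 0" "y (inv q \<circ> p) \<noteq> 0"
    unfolding ga_mult_eq by (auto split: if_splits elim!: sum.not_neutral_contains_not_neutral)
  have "q \<circ> (inv q \<circ> p) permutes {1..k}"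
    by (rule permutes_compose) (use x y q in \<open>auto simp: supp_def\<close>)
  then show "p permutes {1..k}" using q by simp
qed

lemma supp_JM: "k \<le> d \<Longrightarrow> supp k (JM k)"
  unfolding JM_def by (intro supp_sum supp_\<delta> permutes_swap_id) auto

lemma supp_altr: "k \<le> d \<Longrightarrow> supp k (altr k f)"
  unfolding altr_def by (intro supp_sum supp_scale supp_\<delta> stab_permutes)

fun prodJ :: "complex \<Rightarrow> nat \<Rightarrow> (nat \<Rightarrow> nat) \<Rightarrow> complex" where
  "prodJ t 0 = \<delta> id"
| "prodJ t (Suc k) = prodJ t k \<star> (\<delta> id + t \<cdot> JM (Suc k))"

lemma prodJ_A [simp]: "prodJ t k \<in> A"
  by (cases k) auto

lemma supp_prodJ: "k \<le> d \<Longrightarrow> supp k (prodJ t k)"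
proof (induction k)
  case 0
  then show ?case by (auto intro: supp_\<delta> simp: permutes_id)
next
  case (Suc k)
  then show ?case
    by (auto intro!: supp_mul supp_add supp_scale supp_JM supp_\<delta> permutes_id intro: supp_mono)
qed

lemma supp_JM_commute: "supp k x \<Longrightarrow> Suc k \<le> d \<Longrightarrow> x \<star> JM (Suc k) = JM (Suc k) \<star> x"
  by (rule supp_commute) (auto intro: \<delta>_JM_commute)

text \<open>Conjugation by the adjacent transposition turns \<open>transpose m k\<close> into
  \<open>transpose m (Suc k)\<close> for \<open>m < k\<close>; the one summand not reached in this
  way is the adjacent transposition itself.\<close>

lemma JM_Suc_conj:
  assumes "1 \<le> k" "Suc k \<le> d"
  shows "JM (Suc k) = \<delta> (transpose k (Suc k)) \<star> JM k \<star> \<delta> (transpose k (Suc k)) + \<delta> (transpose k (Suc k))"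
proof -
  let ?s = "transpose k (Suc k)"
  have "{1..<Suc k} = insert k {1..<k}" using assms by auto
  then have "JM (Suc k) = \<delta> ?s + (\<Sum>m\<in>{1..<k}. \<delta> (transpose m (Suc k)))"
    unfolding JM_def by simp
  also have "(\<Sum>m\<in>{1..<k}. \<delta> (transpose m (Suc k))) = \<delta> ?s \<star> JM k \<star> \<delta> ?s"
    unfolding JM_def mul_sum_left mul_sum_right
  proof (intro sum.cong refl)
    fix m assume m: "m \<in> {1..<k}"
    have "?s \<circ> transpose m k \<circ> ?s = transpose m (Suc k)"
      using transpose_comp_triple[of "Suc k" m k] m by (simp add: transpose_commute)
    then show "\<delta> (transpose m (Suc k)) = \<delta> ?s \<star> \<delta> (transpose m k) \<star> \<delta> ?s"
      using m assms by (simp add: \<delta>_mul_\<delta>)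
  qed
  finally show ?thesis by (simp add: add.commute)
qed

text \<open>With \<open>X\<close> and \<open>Y\<close> the last two factors and \<open>s\<close> the
  adjacent transposition, \<open>Y = s \<star> X \<star> s + t \<cdot> s\<close>. Substituting this
  for \<open>Y\<close> in \<open>s \<star> X \<star> Y\<close> and in
  \<open>Y \<star> X \<star> s\<close> gives the same expression, and \<open>X\<close>,
  \<open>Y\<close> commute. The earlier factors involve only permutations that fix both points moved
  by \<open>s\<close>.\<close>

lemma prodJ_commute_swap:
  assumes "1 \<le> k" "Suc k \<le> d"
  shows "\<delta> (transpose k (Suc k)) \<star> prodJ t (Suc k) = prodJ t (Suc k) \<star> \<delta> (transpose k (Suc k))"
proof -
  obtain j where j: "k = Suc j" using assms by (cases k) auto
  define s where "s = \<delta> (transpose k (Suc k))"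
  define X where "X = \<delta> id + t \<cdot> JM k"
  define Y where "Y = \<delta> id + t \<cdot> JM (Suc k)"
  define P where "P = prodJ t j"
  have sA [simp]: "s \<in> A" unfolding s_def using assms by auto
  have ss: "s \<star> s = \<delta> id" unfolding s_def using assms by (simp add: \<delta>_mul_\<delta>)
  have Y: "Y = s \<star> X \<star> s + t \<cdot> s"
    unfolding X_def Y_def JM_Suc_conj[OF assms] using assms
    by (simp add: mul_add_left mul_add_right mul_assoc s_def[symmetric] ss cfun.scale_right_distrib)
  have XY: "X \<star> Y = Y \<star> X"
    unfolding X_def Y_def using assms supp_JM_commute[OF supp_JM[of k]]
    by (simp add: mul_add_left mul_add_right algebra_simps)
  have Ps: "P \<star> s = s \<star> P"
  proof (rule supp_commute)
    show "supp j P" unfolding P_def using j assms by (intro supp_prodJ) simp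
    fix g assume g: "g permutes {1..j}"
    have gG: "g \<in> G" using permutes_G[OF g] j assms by simp
    have "g k = k" "g (Suc k) = Suc k" using permutes_not_in[OF g] j by auto
    then have "g \<circ> transpose k (Suc k) = transpose k (Suc k) \<circ> g"
      using G_comp_transpose[OF gG, of k "Suc k"] by simp
    then show "\<delta> g \<star> s = s \<star> \<delta> g" unfolding s_def using gG assms by (simp add: \<delta>_mul_\<delta>)
  qed
  have "s \<star> (X \<star> Y) = s \<star> X \<star> (s \<star> X \<star> s + t \<cdot> s)"
    unfolding Y by (simp add: mul_assoc)
  also have "\<dots> = (s \<star> X \<star> s + t \<cdot> s) \<star> X \<star> s"
    by (simp add: mul_add_left mul_add_right mul_assoc)
  also have "\<dots> = (X \<star> Y) \<star> s"
    unfolding XY by (simp add: Y)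
  finally have sXY: "s \<star> (X \<star> Y) = (X \<star> Y) \<star> s" .
  have eq: "prodJ t (Suc k) = P \<star> (X \<star> Y)"
    unfolding j P_def X_def Y_def by (simp add: mul_assoc)
  show ?thesis
    unfolding eq s_def[symmetric] using sXY Ps by (metis mul_assoc)
qed

text \<open>Permutations of \<open>{1..Suc k}\<close> are generated by those of
  \<open>{1..k}\<close>, which commute with both factors, and the transpositions of
  \<open>Suc k\<close>; conjugation by \<open>transpose m k\<close> reduces the latter to the
  adjacent one.\<close>

lemma prodJ_commute:
  "k \<le> d \<Longrightarrow> g permutes {1..k} \<Longrightarrow> \<delta> g \<star> prodJ t k = prodJ t k \<star> \<delta> g"
proof (induction k arbitrary: g)
  case 0
  then have "g = id" by (simp add: One_nat_def)
  then show ?case by (simp only: prodJ.simps)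
next
  case (Suc k)
  have comm: "\<delta> (p \<circ> q) \<star> x = x \<star> \<delta> (p \<circ> q)"
    if "\<delta> p \<star> x = x \<star> \<delta> p" "\<delta> q \<star> x = x \<star> \<delta> q" "p \<in> G" "q \<in> G" for p q x
    using that by (metis \<delta>_mul_\<delta> mul_assoc)
  have base: "\<delta> q \<star> prodJ t (Suc k) = prodJ t (Suc k) \<star> \<delta> q" if q: "q permutes {1..k}" for q
  proof -
    have qA: "\<delta> q \<in> A" using permutes_G[OF q] Suc.prems by auto
    have "\<delta> q \<star> prodJ t (Suc k) = prodJ t k \<star> (\<delta> q \<star> (\<delta> id + t \<cdot> JM (Suc k)))"
      using Suc.IH[OF _ q] Suc.prems by (simp add: mul_assoc[symmetric])
    also have "\<delta> q \<star> (\<delta> id + t \<cdot> JM (Suc k)) = (\<delta> id + t \<cdot> JM (Suc k)) \<star> \<delta> q"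
      using \<delta>_JM_commute[OF q] Suc.prems qA by (simp add: mul_add_left mul_add_right)
    finally show ?thesis by (simp add: mul_assoc)
  qed
  have tr: "\<delta> (transpose m (Suc k)) \<star> prodJ t (Suc k) = prodJ t (Suc k) \<star> \<delta> (transpose m (Suc k))"
    if m: "m \<in> {1..Suc k}" for m
  proof -
    consider "m = Suc k" | "m = k" "1 \<le> k" | "1 \<le> m" "m < k" using m by force
    then show ?thesis
    proof cases
      case 1
      then show ?thesis by simp
    next
      case 2
      then show ?thesis using prodJ_commute_swap Suc.prems by blast
    next
      case 3
      have eq: "transpose m (Suc k) = transpose m k \<circ> transpose k (Suc k) \<circ> transpose m k"
        using transpose_comp_triple[of m "Suc k" k] 3 by simp
      have mk: "transpose m k permutes {1..k}" using 3 by (intro permutes_swap_id) auto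
      show ?thesis unfolding eq
        using 3 Suc.prems by (intro comm base mk prodJ_commute_swap) auto
    qed
  qed
  \<comment> \<open>For a constant labelling \<open>stab\<close> is the full symmetric group, and
    the coset bijection supplies the factorization of \<open>g\<close>.\<close>
  have "g \<in> stab (Suc k) (\<lambda>_. 0)" using Suc.prems by (simp add: stab_const)
  then have "g \<in> (\<lambda>(m, q). transpose m (Suc k) \<circ> q) ` ({m \<in> {1..Suc k}. (0::nat) = 0} \<times> stab k (\<lambda>_. 0))"
    by (simp only: bij_betw_imp_surj_on[OF bij_betw_stab_Suc[of k "\<lambda>_. 0"]])
  then obtain m q where g: "g = transpose m (Suc k) \<circ> q" "m \<in> {1..Suc k}" "q permutes {1..k}"
    by (auto simp: stab_const)
  show ?case unfolding g(1) using g Suc.prems permutes_G[OF g(3)]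
    by (intro comm base tr) auto
qed

lemma central_prodJ: "central (prodJ t d)"
  unfolding central_def using prodJ_commute[of d] by (auto simp: Sym_def)

end

section \<open>Diagrams and the row-by-row tableau\<close>

definition cell_of :: "nat list \<Rightarrow> nat \<Rightarrow> nat \<times> nat" where
  "cell_of \<nu> x = inv_into (cells \<nu>) (tableau \<nu>) x"

definition row :: "nat list \<Rightarrow> nat \<Rightarrow> nat" where "row \<nu> x = fst (cell_of \<nu> x)"
definition col :: "nat list \<Rightarrow> nat \<Rightarrow> nat" where "col \<nu> x = snd (cell_of \<nu> x)"

text \<open>The sum of the first \<open>m\<close> column lengths. Comparing two diagrams by these
  numbers for all \<open>m\<close> is the dominance order on their conjugates.\<close>

definition cnt :: "nat list \<Rightarrow> nat \<Rightarrow> nat" where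
  "cnt \<nu> m = card {c \<in> cells \<nu>. snd c < m}"

lemma cells_Sigma: "cells \<nu> = (SIGMA i:{..<length \<nu>}. {..<\<nu> ! i})"
  by (auto simp: cells_def)

lemma finite_cells [simp]: "finite (cells \<nu>)"
  by (auto simp: cells_Sigma)

lemma card_cells: "card (cells \<nu>) = sum_list \<nu>"
  by (simp add: cells_Sigma sum_list_sum_nth atLeast0LessThan)

lemma cnt_eq: "cnt \<nu> m = (\<Sum>i<length \<nu>. min (\<nu> ! i) m)"
proof -
  have "{c \<in> cells \<nu>. snd c < m} = (SIGMA i:{..<length \<nu>}. {..<min (\<nu> ! i) m})"
    by (auto simp: cells_def)
  then show ?thesis by (simp add: cnt_def)
qed

lemma partition_nth_mono: "\<nu> \<in> partitions_of d \<Longrightarrow> i \<le> j \<Longrightarrow> j < length \<nu> \<Longrightarrow> \<nu> ! j \<le> \<nu> ! i"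
  by (cases "i = j") (auto simp: partitions_of_def sorted_wrt_iff_nth_less)

lemma cells_down: "\<nu> \<in> partitions_of d \<Longrightarrow> (i, j) \<in> cells \<nu> \<Longrightarrow> i' \<le> i \<Longrightarrow> j' \<le> j \<Longrightarrow> (i', j') \<in> cells \<nu>"
  using partition_nth_mono[of \<nu> d i' i] by (auto simp: cells_def)

lemma cells_eqD:
  assumes "\<kappa> \<in> partitions_of d" "\<mu> \<in> partitions_of d" "cells \<kappa> = cells \<mu>"
  shows "\<kappa> = \<mu>"
proof -
  have len: "i < length \<nu> \<longleftrightarrow> (i, 0) \<in> cells \<nu>" if "\<nu> \<in> partitions_of d" for \<nu> i
    using that by (auto simp: cells_def partitions_of_def) (metis gr0I nth_mem)
  have "i < length \<kappa> \<longleftrightarrow> i < length \<mu>" for i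
    using len assms by simp
  then have l: "length \<kappa> = length \<mu>" by (metis linorder_neqE_nat order_less_irrefl)
  show ?thesis
  proof (rule nth_equalityI[OF l])
    fix i assume i: "i < length \<kappa>"
    have "j < \<kappa> ! i \<longleftrightarrow> j < \<mu> ! i" for j
      using assms(3) i l by (auto simp: cells_def set_eq_iff)
    then show "\<kappa> ! i = \<mu> ! i" by (metis linorder_neqE_nat order_less_irrefl)
  qed
qed

lemma down_closed_eq_lessThan:
  fixes S :: "nat set"
  assumes "finite S" "\<And>i j. j \<in> S \<Longrightarrow> i \<le> j \<Longrightarrow> i \<in> S"
  shows "S = {..<card S}"
proof (cases "S = {}")
  case False
  have "S = {..Max S}"
    using assms False by (auto intro: Max_in)
  then show ?thesis by (metis card_atMost lessThan_Suc_atMost)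
qed auto

text \<open>Successive differences of \<open>cnt\<close> are the column lengths, and a column of a
  diagram is the initial segment of that length.\<close>

lemma cnt_inject:
  assumes "\<kappa> \<in> partitions_of d" "\<mu> \<in> partitions_of d" "\<And>m. cnt \<kappa> m = cnt \<mu> m"
  shows "\<kappa> = \<mu>"
proof (rule cells_eqD[OF assms(1,2)])
  define S where "S = (\<lambda>\<nu> m. {i. (i, m) \<in> cells \<nu>})"
  have fin: "finite (S \<nu> m)" for \<nu> m
    by (rule finite_subset[of _ "{..<length \<nu>}"]) (auto simp: S_def cells_def)
  have card: "card (S \<nu> m) + cnt \<nu> m = cnt \<nu> (Suc m)" for \<nu> m
  proof -
    have "{c \<in> cells \<nu>. snd c < Suc m} = (\<lambda>i. (i, m)) ` S \<nu> m \<union> {c \<in> cells \<nu>. snd c < m}"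
      by (auto simp: S_def less_Suc_eq)
    moreover have "card ((\<lambda>i. (i, m)) ` S \<nu> m) = card (S \<nu> m)"
      by (rule card_image) (auto simp: inj_on_def)
    moreover have "(\<lambda>i. (i, m)) ` S \<nu> m \<inter> {c \<in> cells \<nu>. snd c < m} = {}"
      by auto
    ultimately show ?thesis unfolding cnt_def
      using card_Un_disjoint[of "(\<lambda>i. (i, m)) ` S \<nu> m" "{c \<in> cells \<nu>. snd c < m}"] fin by simp
  qed
  have S: "S \<nu> m = {..<card (S \<nu> m)}" if "\<nu> \<in> partitions_of d" for \<nu> m
    by (rule down_closed_eq_lessThan[OF fin]) (use cells_down[OF that] in \<open>auto simp: S_def\<close>)
  have "card (S \<kappa> m) = card (S \<mu> m)" for m
    using card[of \<kappa> m] card[of \<mu> m] assms(3) by simp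
  then have "S \<kappa> m = S \<mu> m" for m
    using S[OF assms(1), of m] S[OF assms(2), of m] by metis
  then show "cells \<kappa> = cells \<mu>"
    by (auto simp: S_def set_eq_iff)
qed

section \<open>The tableau as a numbering of the cells\<close>

locale young = sym_algebra d for d :: nat +
  fixes \<nu> :: "nat list"
  assumes \<nu>: "\<nu> \<in> partitions_of d"
begin

lemma sum_take_Suc: "i < length \<nu> \<Longrightarrow> sum_list (take (Suc i) \<nu>) = sum_list (take i \<nu>) + \<nu> ! i"
  by (simp add: take_Suc_conv_app_nth)

lemma sum_take_mono: "i \<le> j \<Longrightarrow> sum_list (take i \<nu>) \<le> sum_list (take j \<nu>)"
  by (metis le_add1 le_add_diff_inverse sum_list_append take_add)

lemma tableau_lt: "(i, j) \<in> cells \<nu> \<Longrightarrow> i < i' \<Longrightarrow> tableau \<nu> (i, j) < tableau \<nu> (i', j')"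
  using sum_take_Suc[of i] sum_take_mono[of "Suc i" i'] by (auto simp: cells_def tableau_def)

lemma inj_tableau: "inj_on (tableau \<nu>) (cells \<nu>)"
proof (rule inj_onI, clarify)
  fix i j i' j' assume *: "(i, j) \<in> cells \<nu>" "(i', j') \<in> cells \<nu>" "tableau \<nu> (i, j) = tableau \<nu> (i', j')"
  then have "i = i'" using tableau_lt[of i j i' j'] tableau_lt[of i' j' i j] by (metis nat_neq_iff)
  then show "i = i' \<and> j = j'" using * by (simp add: tableau_def)
qed

lemma sum_list_\<nu>: "sum_list \<nu> = d"
  using \<nu> by (simp add: partitions_of_def)

lemma bij_tableau: "bij_betw (tableau \<nu>) (cells \<nu>) {1..d}"
proof -
  have sub: "tableau \<nu> ` cells \<nu> \<subseteq> {1..d}"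
  proof clarify
    fix i j assume "(i, j) \<in> cells \<nu>"
    then show "tableau \<nu> (i, j) \<in> {1..d}"
      using sum_take_Suc[of i] sum_take_mono[of "Suc i" "length \<nu>"] sum_list_\<nu>
      by (auto simp: cells_def tableau_def)
  qed
  have "tableau \<nu> ` cells \<nu> = {1..d}"
    by (rule card_subset_eq[OF _ sub]) (simp_all add: card_image[OF inj_tableau] card_cells sum_list_\<nu>)
  then show ?thesis using inj_tableau by (simp add: bij_betw_def)
qed

lemma cell: "x \<in> {1..d} \<Longrightarrow> (row \<nu> x, col \<nu> x) \<in> cells \<nu>"
  using bij_tableau unfolding row_def col_def cell_of_def bij_betw_def
  by (simp add: inv_into_into)

lemma tableau_cell: "x \<in> {1..d} \<Longrightarrow> tableau \<nu> (row \<nu> x, col \<nu> x) = x"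
  using bij_tableau unfolding row_def col_def cell_of_def bij_betw_def
  by (simp add: f_inv_into_f)

lemma tableau_range: "(i, j) \<in> cells \<nu> \<Longrightarrow> tableau \<nu> (i, j) \<in> {1..d}"
  using bij_tableau by (auto simp: bij_betw_def)

lemma row_tableau [simp]: "(i, j) \<in> cells \<nu> \<Longrightarrow> row \<nu> (tableau \<nu> (i, j)) = i"
  and col_tableau [simp]: "(i, j) \<in> cells \<nu> \<Longrightarrow> col \<nu> (tableau \<nu> (i, j)) = j"
  using inj_tableau by (auto simp: row_def col_def cell_of_def)

lemma row_lt: "x \<in> {1..d} \<Longrightarrow> y \<in> {1..d} \<Longrightarrow> row \<nu> x < row \<nu> y \<Longrightarrow> x < y"
  using tableau_lt[OF cell[of x], of "row \<nu> y" "col \<nu> y"] by (simp add: tableau_cell)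

lemma row_mono: "x \<in> {1..d} \<Longrightarrow> y \<in> {1..d} \<Longrightarrow> x \<le> y \<Longrightarrow> row \<nu> x \<le> row \<nu> y"
  using row_lt[of y x] by force

lemma col_lt: "x \<in> {1..d} \<Longrightarrow> y \<in> {1..d} \<Longrightarrow> row \<nu> x = row \<nu> y \<Longrightarrow> x < y \<longleftrightarrow> col \<nu> x < col \<nu> y"
  using tableau_cell[of x] tableau_cell[of y] by (auto simp: tableau_def)

lemma row_col_inj: "x \<in> {1..d} \<Longrightarrow> y \<in> {1..d} \<Longrightarrow> row \<nu> x = row \<nu> y \<Longrightarrow> col \<nu> x = col \<nu> y \<Longrightarrow> x = y"
  by (metis tableau_cell)

lemma bij_cell: "bij_betw (\<lambda>x. (row \<nu> x, col \<nu> x)) {1..d} (cells \<nu>)"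
  by (rule bij_betwI[where g = "tableau \<nu>"]) (auto simp: cell tableau_cell dest: tableau_range)

lemma row_entries_eq: "row_entries \<nu> i = {x \<in> {1..d}. row \<nu> x = i}"
proof -
  have "x \<in> row_entries \<nu> i" if "x \<in> {1..d}" "row \<nu> x = i" for x
    unfolding row_entries_def using that cell[of x] tableau_cell[of x] by (intro image_eqI[of _ _ "(row \<nu> x, col \<nu> x)"]) auto
  then show ?thesis by (auto simp: row_entries_def dest: tableau_range)
qed

lemma col_entries_eq: "col_entries \<nu> j = {x \<in> {1..d}. col \<nu> x = j}"
proof -
  have "x \<in> col_entries \<nu> j" if "x \<in> {1..d}" "col \<nu> x = j" for x
    unfolding col_entries_def using that cell[of x] tableau_cell[of x] by (intro image_eqI[of _ _ "(row \<nu> x, col \<nu> x)"]) auto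
  then show ?thesis by (auto simp: col_entries_def dest: tableau_range)
qed

lemma preserve_fibres_iff:
  assumes "p \<in> G"
  shows "(\<forall>i. p ` {x \<in> {1..d}. f x = i} = {x \<in> {1..d}. f x = i}) \<longleftrightarrow> p \<in> stab d f"
proof
  assume *: "\<forall>i. p ` {x \<in> {1..d}. f x = i} = {x \<in> {1..d}. f x = i}"
  show "p \<in> stab d f"
  proof (rule stabI)
    fix x assume "x \<in> {1..d}"
    then have "p x \<in> p ` {y \<in> {1..d}. f y = f x}" by auto
    then show "f (p x) = f x" using * by auto
  qed (use assms in \<open>simp add: Sym_def\<close>)
next
  assume p: "p \<in> stab d f"
  show "\<forall>i. p ` {x \<in> {1..d}. f x = i} = {x \<in> {1..d}. f x = i}"
  proof (intro allI card_subset_eq)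
    fix i
    show "p ` {x \<in> {1..d}. f x = i} \<subseteq> {x \<in> {1..d}. f x = i}"
      using stab_app[OF p] G_range[OF assms] by auto
    show "card (p ` {x \<in> {1..d}. f x = i}) = card {x \<in> {1..d}. f x = i}"
      using bij_is_inj[OF G_bij[OF assms]] by (intro card_image) (auto simp: inj_on_def)
  qed auto
qed

lemma row_group_eq: "row_group d \<nu> = stab d (row \<nu>)"
  unfolding row_group_def row_entries_eq using preserve_fibres_iff stab_G[of _ d] by blast

lemma col_group_eq: "col_group d \<nu> = stab d (col \<nu>)"
  unfolding col_group_def col_entries_eq using preserve_fibres_iff stab_G[of _ d] by blast

definition a where "a = symr d (row \<nu>)"
definition b where "b = altr d (col \<nu>)"
definition c where "c = young_symmetrizer d \<nu>"

lemma a_A [simp]: "a \<in> A" and b_A [simp]: "b \<in> A"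
  by (auto simp: a_def b_def)

lemma c_eq: "c = a \<star> b"
  unfolding c_def young_symmetrizer_def a_def b_def row_group_eq col_group_eq
  by (intro arg_cong2[where f = "ga_mult d"]) (auto simp: fun_eq_iff symr_app altr_app)

lemma c_A [simp]: "c \<in> A"
  by (simp add: c_eq)

lemma cnt_col:
  assumes "h \<in> G"
  shows "card {x \<in> {1..d}. col \<nu> (h x) < m} = cnt \<nu> m"
  unfolding cnt_def
proof (rule bij_betw_same_card)
  have "bij_betw h {1..d} {1..d}" using assms by (simp add: Sym_def permutes_imp_bij)
  from bij_betw_trans[OF this bij_cell]
  have bij: "bij_betw (\<lambda>x. (row \<nu> (h x), col \<nu> (h x))) {1..d} (cells \<nu>)" by (simp add: o_def)
  show "bij_betw (\<lambda>x. (row \<nu> (h x), col \<nu> (h x))) {x \<in> {1..d}. col \<nu> (h x) < m} {c \<in> cells \<nu>. snd c < m}"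
    by (rule bij_betw_subset[OF bij]) (auto simp: bij_betw_imp_surj_on[OF bij, symmetric])
qed

section \<open>Labellings with distinct values in each row\<close>

context
  fixes f :: "nat \<Rightarrow> nat"
  assumes f: "\<And>x y. x \<in> {1..d} \<Longrightarrow> y \<in> {1..d} \<Longrightarrow> x \<noteq> y \<Longrightarrow> row \<nu> x = row \<nu> y \<Longrightarrow> f x \<noteq> f y"
begin

lemma card_row: "i < length \<nu> \<Longrightarrow> card {x \<in> {1..d}. row \<nu> x = i} = \<nu> ! i"
proof -
  assume i: "i < length \<nu>"
  have "bij_betw (col \<nu>) {x \<in> {1..d}. row \<nu> x = i} {..<\<nu> ! i}"
    by (rule bij_betwI[where g = "\<lambda>j. tableau \<nu> (i, j)"])
       (use i cell tableau_range tableau_cell in \<open>auto simp: cells_def\<close>)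
  then show ?thesis using bij_betw_same_card by fastforce
qed

lemma card_row_le:
  assumes "i < length \<nu>"
  shows "card {x \<in> {1..d}. row \<nu> x = i \<and> f x < m} \<le> min (\<nu> ! i) m"
proof (rule min.boundedI)
  show "card {x \<in> {1..d}. row \<nu> x = i \<and> f x < m} \<le> \<nu> ! i"
    unfolding card_row[OF assms, symmetric] by (rule card_mono) auto
  have "inj_on f {x \<in> {1..d}. row \<nu> x = i \<and> f x < m}"
  proof (rule inj_onI)
    fix x y assume "x \<in> {x \<in> {1..d}. row \<nu> x = i \<and> f x < m}" "y \<in> {x \<in> {1..d}. row \<nu> x = i \<and> f x < m}" "f x = f y"
    then show "x = y" using f[of x y] by auto
  qed
  then show "card {x \<in> {1..d}. row \<nu> x = i \<and> f x < m} \<le> m"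
    using card_inj_on_le[of f _ "{..<m}"] by fastforce
qed

lemma card_split_rows:
  "card {x \<in> {1..d}. f x < m} = (\<Sum>i<length \<nu>. card {x \<in> {1..d}. row \<nu> x = i \<and> f x < m})"
proof -
  have "{x \<in> {1..d}. f x < m} = (\<Union>i<length \<nu>. {x \<in> {1..d}. row \<nu> x = i \<and> f x < m})"
    using cell by (auto simp: cells_def)
  then show ?thesis by (simp only:) (subst card_UN_disjoint, auto)
qed

text \<open>Labels are distinct within a row, so row \<open>i\<close> has at most
  \<open>min (\<nu> ! i) m\<close> labels below \<open>m\<close>, which is its share of the first
  \<open>m\<close> columns. With labels taken from the columns of a second diagram this yields the
  dominance comparison of the two.\<close>

lemma card_le_cnt: "card {x \<in> {1..d}. f x < m} \<le> cnt \<nu> m"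
  unfolding card_split_rows cnt_eq by (intro sum_mono card_row_le) auto

text \<open>Every row attains its maximal number \<open>min (\<nu> ! i) m\<close> of values below \<open>m\<close>, since the totals agree;
  take \<open>m\<close> to be the length of the row.\<close>

lemma cell_row_f:
  assumes eq: "\<And>m. card {x \<in> {1..d}. f x < m} = cnt \<nu> m" and x: "x \<in> {1..d}"
  shows "(row \<nu> x, f x) \<in> cells \<nu>"
proof -
  define i where "i = row \<nu> x"
  have i: "i < length \<nu>" using cell[OF x] by (auto simp: cells_def i_def)
  have "card {x \<in> {1..d}. row \<nu> x = i \<and> f x < \<nu> ! i} = min (\<nu> ! i) (\<nu> ! i)"
  proof (rule sum_mono_inv[where I = "{..<length \<nu>}" and g = "\<lambda>k. min (\<nu> ! k) (\<nu> ! i)"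
        and f = "\<lambda>k. card {x \<in> {1..d}. row \<nu> x = k \<and> f x < \<nu> ! i}"])
    show "(\<Sum>k<length \<nu>. card {x \<in> {1..d}. row \<nu> x = k \<and> f x < \<nu> ! i}) = (\<Sum>k<length \<nu>. min (\<nu> ! k) (\<nu> ! i))"
      using eq[of "\<nu> ! i"] unfolding card_split_rows cnt_eq .
  qed (use i card_row_le in auto)
  then have "card {x \<in> {1..d}. row \<nu> x = i \<and> f x < \<nu> ! i} = card {x \<in> {1..d}. row \<nu> x = i}"
    using card_row[OF i] by simp
  then have "{x \<in> {1..d}. row \<nu> x = i \<and> f x < \<nu> ! i} = {x \<in> {1..d}. row \<nu> x = i}"
    by (intro card_subset_eq) auto
  then have "f x < \<nu> ! i" using x by (auto simp: i_def)
  then show ?thesis using i by (simp add: cells_def i_def)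
qed

end

section \<open>Elements with the symmetry of the Young symmetrizer\<close>

text \<open>Each \<open>x\<close> is moved within its row to the column of \<open>inv g x\<close>.
  By the count of labels that cell exists, and by \<open>disj\<close> no two entries collide, so
  this is a row permutation \<open>p'\<close>. Then \<open>p' \<circ> g\<close> preserves columns,
  and \<open>g\<close> is \<open>inv p'\<close> followed on the right by it.\<close>

lemma row_col_factor:
  assumes g: "g \<in> G"
    and disj: "\<And>x y. x \<in> {1..d} \<Longrightarrow> y \<in> {1..d} \<Longrightarrow> x \<noteq> y \<Longrightarrow> row \<nu> x = row \<nu> y
               \<Longrightarrow> col \<nu> (inv g x) \<noteq> col \<nu> (inv g y)"
  obtains p q where "p \<in> stab d (row \<nu>)" "q \<in> stab d (col \<nu>)" "g = p \<circ> q"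
proof -
  define f where "f = (\<lambda>x. col \<nu> (inv g x))"
  have cellf: "(row \<nu> x, f x) \<in> cells \<nu>" if "x \<in> {1..d}" for x
    using cell_row_f[of f] disj cnt_col[of "inv g"] g that by (auto simp: f_def)
  define p' where "p' = (\<lambda>x. if x \<in> {1..d} then tableau \<nu> (row \<nu> x, f x) else x)"
  have p'_in: "p' x \<in> {1..d}" if "x \<in> {1..d}" for x
    using tableau_range[OF cellf[OF that]] that by (simp add: p'_def)
  have p'_row: "row \<nu> (p' x) = row \<nu> x" and p'_col: "col \<nu> (p' x) = f x" if "x \<in> {1..d}" for x
    using cellf[OF that] that by (simp_all add: p'_def)
  have "inj_on p' {1..d}"
  proof (rule inj_onI)
    fix x y assume xy: "x \<in> {1..d}" "y \<in> {1..d}" "p' x = p' y"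
    then have "row \<nu> x = row \<nu> y" "f x = f y" using p'_row p'_col by metis+
    then show "x = y" using disj xy unfolding f_def by blast
  qed
  then have perm: "p' permutes {1..d}"
    using p'_in by (intro inj_imp_permutes) (auto simp: p'_def)
  then have p'G: "p' \<in> G" by (simp add: Sym_def)
  have p'R: "p' \<in> stab d (row \<nu>)" using perm p'_row by (intro stabI)
  have "p' \<circ> g \<in> G" using p'G g by simp
  then have "p' \<circ> g \<in> stab d (col \<nu>)"
  proof (intro stabI)
    fix x assume x: "x \<in> {1..d}"
    then show "col \<nu> ((p' \<circ> g) x) = col \<nu> x"
      using p'_col[of "g x"] g x by (simp add: f_def del: atLeastAtMost_iff)
  qed (simp add: Sym_def)
  moreover have "inv p' \<in> stab d (row \<nu>)" using p'R by (rule inv_stab)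
  moreover have "g = inv p' \<circ> (p' \<circ> g)" using p'G by simp
  ultimately show ?thesis using that by blast
qed

lemma conj_transpose: "g \<in> G \<Longrightarrow> transpose x y \<circ> g = g \<circ> transpose (inv g x) (inv g y)"
  by (rule transpose_comp_eq[OF G_bij])

lemma stab_row_col: "p \<in> stab d (row \<nu>) \<Longrightarrow> p \<in> stab d (col \<nu>) \<Longrightarrow> p = id"
proof
  fix x assume p: "p \<in> stab d (row \<nu>)" "p \<in> stab d (col \<nu>)"
  show "p x = id x"
  proof (cases "x \<in> {1..d}")
    case True
    then have "p x \<in> {1..d}" using stab_G[OF p(1)] by (simp del: atLeastAtMost_iff)
    then show ?thesis using row_col_inj[of "p x" x] p True by (simp add: stab_app)
  next
    case False
    then show ?thesis using stab_permutes[OF p(1)] by (simp add: permutes_not_in)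
  qed
qed

text \<open>A row permutation whose inverse preserves columns fixes every cell, so \<open>id\<close>
  arises once in the product. This normalization lets scalars be read off as coefficients at
  \<open>id\<close>.\<close>

lemma c_id: "c id = 1"
proof -
  have "c id = (\<Sum>p\<in>G. a p * b (inv p \<circ> id))" unfolding c_eq ga_mult_eq by simp
  also have "\<dots> = (\<Sum>p\<in>G. if p = id then 1 else 0)"
  proof (rule sum.cong[OF refl])
    fix p assume p: "p \<in> G"
    show "a p * b (inv p \<circ> id) = (if p = id then 1 else 0)"
    proof (cases "p \<in> stab d (row \<nu>) \<and> inv p \<in> stab d (col \<nu>)")
      case True
      then have "p = id" using stab_row_col[of p] inv_stab[of "inv p" d "col \<nu>"] p by simp
      then show ?thesis by (simp add: a_def b_def symr_app altr_app)
    next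
      case False
      then have "p \<noteq> id" by auto
      then show ?thesis using False by (auto simp: a_def b_def symr_app altr_app)
    qed
  qed
  finally show ?thesis by simp
qed

lemma \<delta>_c: "p \<in> stab d (row \<nu>) \<Longrightarrow> \<delta> p \<star> c = c"
  unfolding c_eq a_def by (simp add: mul_assoc[symmetric] \<delta>_symr)

lemma c_\<delta>: "q \<in> stab d (col \<nu>) \<Longrightarrow> c \<star> \<delta> q = of_int (sign q) \<cdot> c"
  unfolding c_eq b_def by (simp add: mul_assoc altr_\<delta>)

text \<open>If two entries share a row and their preimages under \<open>g\<close> share a column,
  then \<open>t \<circ> g = g \<circ> s\<close> with a row transposition \<open>t\<close> and a
  column transposition \<open>s\<close>, which forces \<open>u g = - u g\<close>. Otherwise
  \<open>g\<close> factors into a row and a column permutation, and \<open>u g\<close> is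
  \<open>u id\<close> up to sign.\<close>

lemma equivariant_zero:
  assumes u: "u \<in> A" and L: "\<And>p. p \<in> stab d (row \<nu>) \<Longrightarrow> \<delta> p \<star> u = u"
    and R: "\<And>q. q \<in> stab d (col \<nu>) \<Longrightarrow> u \<star> \<delta> q = of_int (sign q) \<cdot> u"
    and u0: "u id = 0"
  shows "u = 0"
proof (rule A_eqI[OF u])
  fix g assume g: "g \<in> G"
  show "u g = 0 g"
  proof (cases "\<exists>x\<in>{1..d}. \<exists>y\<in>{1..d}. x \<noteq> y \<and> row \<nu> x = row \<nu> y \<and> col \<nu> (inv g x) = col \<nu> (inv g y)")
    case True
    then obtain x y where xy: "x \<in> {1..d}" "y \<in> {1..d}" "x \<noteq> y" "row \<nu> x = row \<nu> y"
      "col \<nu> (inv g x) = col \<nu> (inv g y)" by blast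
    define t where "t = transpose x y"
    define s where "s = transpose (inv g x) (inv g y)"
    have tG: "t \<in> G" and sG: "s \<in> G" unfolding t_def s_def using xy g by (auto simp del: atLeastAtMost_iff)
    have t: "t \<in> stab d (row \<nu>)" unfolding t_def using xy by (intro transpose_stab)
    have s: "s \<in> stab d (col \<nu>)" unfolding s_def using xy g by (intro transpose_stab) (auto simp del: atLeastAtMost_iff)
    have "inv g x \<noteq> inv g y" using xy(3) g by (metis G_inv_app(2))
    then have sgn: "sign s = -1" by (simp add: s_def sign_swap_id)
    have "u g = u (t \<circ> g)" using arg_cong[OF L[OF t], of "\<lambda>v. v g"] tG g by (simp add: \<delta>_mul_app t_def)
    also have "\<dots> = u (g \<circ> s)" using conj_transpose[OF g, of x y] by (simp add: t_def s_def)
    also have "\<dots> = - u g" using arg_cong[OF R[OF s], of "\<lambda>v. v g"] sG g sgn by (simp add: mul_\<delta>_app s_def)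
    finally show ?thesis by (simp add: zero_fun_apply)
  next
    case False
    then obtain p q where pq: "p \<in> stab d (row \<nu>)" "q \<in> stab d (col \<nu>)" "g = p \<circ> q"
      using row_col_factor[OF g] by blast
    have pG: "p \<in> G" and qG: "q \<in> G" using pq stab_G by auto
    have "u g = u q" using arg_cong[OF L[OF pq(1)], of "\<lambda>v. v g"] pG qG pq(3) by (simp add: \<delta>_mul_app)
    \<comment> \<open>Evaluated at \<open>q\<close>, right translation by \<open>q\<close> reads the
      coefficient at \<open>id\<close>.\<close>
    moreover have "u id = of_int (sign q) * u q"
      using arg_cong[OF R[OF pq(2)], of "\<lambda>v. v q"] qG by (simp add: mul_\<delta>_app)
    ultimately show ?thesis using u0 by (simp add: zero_fun_apply)
  qed
qed simp

text \<open>\<open>c\<close> has the required symmetry and coefficient 1 at \<open>id\<close>, so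
  subtracting a multiple of it reduces to the vanishing statement. The symmetry type thus has
  multiplicity one.\<close>

lemma equivariant_eq:
  assumes u: "u \<in> A" and L: "\<And>p. p \<in> stab d (row \<nu>) \<Longrightarrow> \<delta> p \<star> u = u"
    and R: "\<And>q. q \<in> stab d (col \<nu>) \<Longrightarrow> u \<star> \<delta> q = of_int (sign q) \<cdot> u"
  shows "u = u id \<cdot> c"
proof -
  have "u - u id \<cdot> c = 0"
  proof (rule equivariant_zero)
    show "(u - u id \<cdot> c) id = 0" by (simp add: c_id)
    show "\<delta> p \<star> (u - u id \<cdot> c) = u - u id \<cdot> c" if "p \<in> stab d (row \<nu>)" for p
      using that by (simp add: mul_diff_right L \<delta>_c)
    show "(u - u id \<cdot> c) \<star> \<delta> q = of_int (sign q) \<cdot> (u - u id \<cdot> c)" if "q \<in> stab d (col \<nu>)" for q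
      using that by (simp add: mul_diff_left R c_\<delta> cfun.scale_right_diff_distrib mult.commute)
  qed (use u in auto)
  then show ?thesis by simp
qed

lemma c_mul_c: "c \<star> x \<star> c = (c \<star> x \<star> c) id \<cdot> c"
proof (rule equivariant_eq)
  show "\<delta> p \<star> (c \<star> x \<star> c) = c \<star> x \<star> c" if "p \<in> stab d (row \<nu>)" for p
    using that by (simp add: mul_assoc[symmetric] \<delta>_c)
  show "c \<star> x \<star> c \<star> \<delta> q = of_int (sign q) \<cdot> (c \<star> x \<star> c)" if "q \<in> stab d (col \<nu>)" for q
    using that by (simp add: mul_assoc c_\<delta>)
qed simp

text \<open>The factor by which \<open>c\<close> fails to be idempotent,
  \<open>c \<star> c = n \<cdot> c\<close>. Its value is d! divided by the dimension, that is, the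
  product of the hook lengths.\<close>

definition n where "n = (c \<star> c) id"

lemma c_c: "c \<star> c = n \<cdot> c"
  using c_mul_c[of "\<delta> id"] by (simp add: n_def)

text \<open>The central character when \<open>z\<close> is central. As a coefficient it is linear on
  all functions, while multiplicativity is claimed for central elements only.\<close>

definition om where "om z = (z \<star> c) id"

lemma central_c:
  assumes "central z"
  shows "z \<star> c = om z \<cdot> c"
  unfolding om_def
proof (rule equivariant_eq)
  show "\<delta> p \<star> (z \<star> c) = z \<star> c" if "p \<in> stab d (row \<nu>)" for p
  proof -
    have "\<delta> p \<star> (z \<star> c) = z \<star> (\<delta> p \<star> c)"
      using assms stab_G[OF that] by (simp add: mul_assoc[symmetric] central_def)
    then show ?thesis using \<delta>_c[OF that] by simp
  qed
  show "z \<star> c \<star> \<delta> q = of_int (sign q) \<cdot> (z \<star> c)" if "q \<in> stab d (col \<nu>)" for q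
    using that by (simp add: mul_assoc c_\<delta>)
qed simp

lemma om_mul: "central x \<Longrightarrow> central y \<Longrightarrow> om (x \<star> y) = om x * om y"
  unfolding om_def[of "x \<star> y"] by (simp add: mul_assoc central_c c_id)

lemma om_one: "om (\<delta> id) = 1"
  by (simp add: om_def c_id)

lemma om_add: "om (x + y) = om x + om y" and om_scale: "om (k \<cdot> x) = k * om x"
  by (simp_all add: om_def mul_add_left plus_fun_apply)

end

section \<open>Cycle types and conjugacy\<close>

text \<open>The first return time of \<open>x\<close> is both its period and the number of points on
  its cycle.\<close>

lemma funpow_eq_iff_mod_card_orbit:
  assumes "permutation p"
  shows "(p ^^ k) x = (p ^^ l) x \<longleftrightarrow> k mod card (orbit p x) = l mod card (orbit p x)"
proof -
  define N where "N = funpow_dist1 p x x"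
  have self: "x \<in> orbit p x" by (rule permutation_self_in_orbit[OF assms])
  have inj: "inj_on (\<lambda>n. (p ^^ n) x) {0..<N}" unfolding N_def by (rule inj_on_funpow_dist1[OF self])
  have N: "card (orbit p x) = N"
    using card_image[OF inj] orbit_conv_funpow_dist1[OF self] by (simp add: N_def)
  have per: "(p ^^ N) x = x" unfolding N_def by (rule funpow_dist1_prop[OF self])
  have pos: "N > 0" by (simp add: N_def)
  have "(p ^^ k) x = (p ^^ l) x \<longleftrightarrow> (p ^^ (k mod N)) x = (p ^^ (l mod N)) x"
    by (simp add: funpow_mod_eq[OF per])
  also have "\<dots> \<longleftrightarrow> k mod N = l mod N"
    using inj_onD[OF inj, of "k mod N" "l mod N"] pos by auto
  finally show ?thesis by (simp add: N)
qed

text \<open>Serves to pair the cycles of two permutations of equal cycle type, length with length.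
  The induction removes one element and a partner of equal value.\<close>

lemma image_mset_eq_bij:
  assumes "finite P" "finite Q" "image_mset f (mset_set P) = image_mset g (mset_set Q)"
  shows "\<exists>F. bij_betw F P Q \<and> (\<forall>x\<in>P. g (F x) = f x)"
  using assms
proof (induction P arbitrary: Q rule: finite_induct)
  case empty
  then have "Q = {}" by (simp add: mset_set_empty_iff)
  then show ?case by (auto simp: bij_betw_def)
next
  case (insert x P)
  have "f x \<in># image_mset g (mset_set Q)"
    unfolding insert.prems(2)[symmetric] using insert.hyps by simp
  then obtain y where y: "y \<in> Q" "g y = f x" using insert.prems by auto
  have Q: "mset_set Q = add_mset y (mset_set (Q - {y}))"
    by (rule mset_set.remove[OF insert.prems(1) y(1)])
  have "image_mset f (mset_set P) = image_mset g (mset_set (Q - {y}))"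
    using insert.prems(2) insert.hyps y by (simp add: Q)
  then obtain F where F: "bij_betw F P (Q - {y})" "\<forall>x\<in>P. g (F x) = f x"
    using insert.IH[of "Q - {y}"] insert.prems(1) by auto
  let ?F = "F(x := y)"
  have "bij_betw ?F P (Q - {y})"
    using F(1) insert.hyps by (subst bij_betw_cong[of _ _ F]) auto
  then have "bij_betw ?F (P \<union> {x}) (Q - {y} \<union> {y})"
    by (intro bij_betw_combine) (auto simp: bij_betw_def)
  then show ?case using F(2) y insert.hyps by (intro exI[of _ ?F]) (auto simp: insert_absorb fun_upd_def)
qed

context sym_algebra
begin

lemma orbit_self: "p \<in> G \<Longrightarrow> x \<in> orbit p x"
  by (rule permutation_self_in_orbit[OF G_permutation])

lemma orbit_eq: "p \<in> G \<Longrightarrow> y \<in> orbit p x \<Longrightarrow> orbit p y = orbit p x"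
  by (meson orbit_self orbit_swap orbit_trans subsetI subset_antisym)

lemma orbit_sub: "p \<in> G \<Longrightarrow> x \<in> {1..d} \<Longrightarrow> orbit p x \<subseteq> {1..d}"
  using permutes_orbit_subset[of p "{1..d}" x] by (simp add: Sym_def)

lemma cycle_type_conj:
  assumes "g \<in> G" "p \<in> G"
  shows "cycle_type d (g \<circ> p \<circ> inv g) = cycle_type d p"
proof -
  let ?q = "g \<circ> p \<circ> inv g"
  have orb: "orbit ?q (g x) = g ` orbit p x" for x
    by (rule orbit_inverse[symmetric]) (use assms in \<open>auto intro: orbit_self\<close>)
  have "orbit ?q ` {1..d} = orbit ?q ` g ` {1..d}"
    using assms(1) by (simp add: Sym_def permutes_image)
  also have "\<dots> = (`) g ` (orbit p ` {1..d})"
    by (simp add: image_image orb)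
  finally have eq: "orbit ?q ` {1..d} = (`) g ` (orbit p ` {1..d})" .
  have inj: "inj g" using assms by (simp add: G_bij bij_is_inj)
  have "inj_on ((`) g) (orbit p ` {1..d})"
    using inj by (auto simp: inj_on_def inj_image_eq_iff)
  then have "mset_set (orbit ?q ` {1..d}) = image_mset ((`) g) (mset_set (orbit p ` {1..d}))"
    unfolding eq by (rule image_mset_mset_set[symmetric])
  then have "cycle_type d ?q = image_mset (card \<circ> (`) g) (mset_set (orbit p ` {1..d}))"
    by (simp only: cycle_type_def image_mset.compositionality)
  also have "card \<circ> (`) g = card"
    using inj by (auto simp: fun_eq_iff card_image inj_on_subset)
  finally show ?thesis by (simp only: cycle_type_def)
qed

lemma cycle_type_inv: "p \<in> G \<Longrightarrow> cycle_type d (inv p) = cycle_type d p"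
  unfolding cycle_type_def using orbit_inv_eq[OF G_permutation[of p]] by (simp cong: image_cong)

text \<open>After pairing cycles of equal length by \<open>F\<close>, choose a base point on each
  cycle of \<open>p\<close> and on its partner, and send the point reached after \<open>k x\<close>
  steps of \<open>p\<close> to the point reached after as many steps of \<open>q\<close>. Equal
  lengths make this injective and compatible with one further step, also where a cycle
  closes.\<close>

lemma cycle_type_eq_imp_conj:
  assumes p: "p \<in> G" and q: "q \<in> G" and eq: "cycle_type d p = cycle_type d q"
  obtains g where "g \<in> G" "q = g \<circ> p \<circ> inv g"
proof -
  define P where "P = orbit p ` {1..d}"
  define Q where "Q = orbit q ` {1..d}"
  obtain F where F: "bij_betw F P Q" "\<And>S. S \<in> P \<Longrightarrow> card (F S) = card S"
    using image_mset_eq_bij[of P Q card card] eq by (auto simp: P_def Q_def cycle_type_def)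
  \<comment> \<open>Both choices depend on \<open>x\<close> only through the set
    \<open>orbit p x\<close>, so all points of a cycle share their base points.\<close>
  define rp where "rp = (\<lambda>x. SOME y. y \<in> orbit p x)"
  define rq where "rq = (\<lambda>x. SOME y. y \<in> F (orbit p x))"
  define k where "k = (\<lambda>x. funpow_dist p (rp x) x)"
  define h where "h = (\<lambda>x. if x \<in> {1..d} then (q ^^ k x) (rq x) else x)"
  have permp: "permutation p" and permq: "permutation q" using p q G_permutation by auto
  have rp: "rp x \<in> orbit p x" for x unfolding rp_def by (rule someI) (rule orbit_self[OF p])
  have x_k: "(p ^^ k x) (rp x) = x" for x
    unfolding k_def using orbit_self[OF p, of x] orbit_eq[OF p rp, of x] by (intro funpow_dist_prop) simp
  have FQ: "F (orbit p x) \<in> Q" if "x \<in> {1..d}" for x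
    using F(1) that by (auto simp: bij_betw_def P_def)
  have rq: "rq x \<in> F (orbit p x)" if x: "x \<in> {1..d}" for x
  proof -
    obtain y where "F (orbit p x) = orbit q y" using FQ[OF x] by (auto simp: Q_def)
    then have "y \<in> F (orbit p x)" by (simp add: orbit_self[OF q])
    then show ?thesis unfolding rq_def by (rule someI)
  qed
  have Forb: "orbit q (rq x) = F (orbit p x)" if x: "x \<in> {1..d}" for x
  proof -
    obtain y where y: "F (orbit p x) = orbit q y" using FQ[OF x] by (auto simp: Q_def)
    show ?thesis using rq[OF x] orbit_eq[OF q, of "rq x" y] y by simp
  qed
  have card_eq: "card (orbit q (rq x)) = card (orbit p (rp x))" if x: "x \<in> {1..d}" for x
    using Forb[OF x] F(2)[of "orbit p x"] orbit_eq[OF p rp, of x] x by (simp add: P_def)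
  \<comment> \<open>Both sides say that \<open>i\<close> and \<open>j\<close> agree modulo the
    common cycle length.\<close>
  have transfer: "(q ^^ i) (rq x) = (q ^^ j) (rq x) \<longleftrightarrow> (p ^^ i) (rp x) = (p ^^ j) (rp x)"
    if "x \<in> {1..d}" for i j x
    using card_eq[OF that] by (simp add: funpow_eq_iff_mod_card_orbit[OF permp] funpow_eq_iff_mod_card_orbit[OF permq])
  have h_orb: "orbit q (h x) = F (orbit p x)" if x: "x \<in> {1..d}" for x
    using orbit_eq[OF q funpow_in_orbit[OF orbit_self[OF q]], of "k x" "rq x"] Forb[OF x] x by (simp add: h_def)
  have h_in: "h x \<in> {1..d}" if x: "x \<in> {1..d}" for x
  proof -
    obtain y where y: "y \<in> {1..d}" "F (orbit p x) = orbit q y" using FQ[OF x] by (auto simp: Q_def)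
    show ?thesis using h_orb[OF x] orbit_self[OF q, of "h x"] y orbit_sub[OF q y(1)] by auto
  qed
  have "inj_on h {1..d}"
  proof (rule inj_onI)
    fix x y assume x: "x \<in> {1..d}" and y: "y \<in> {1..d}" and hxy: "h x = h y"
    have "F (orbit p x) = F (orbit p y)" using h_orb[OF x] h_orb[OF y] hxy by simp
    then have o: "orbit p x = orbit p y"
      using F(1) x y by (auto simp: bij_betw_def P_def inj_on_def)
    then have r: "rp x = rp y" "rq x = rq y" by (simp_all add: rp_def rq_def)
    have "(q ^^ k x) (rq x) = (q ^^ k y) (rq x)" using hxy x y r by (simp add: h_def)
    then have "(p ^^ k x) (rp x) = (p ^^ k y) (rp y)" using transfer[OF x] r by simp
    then show "x = y" by (simp add: x_k)
  qed
  then have "h permutes {1..d}" by (intro inj_imp_permutes h_in) (auto simp: h_def)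
  then have h: "h \<in> G" by (simp add: Sym_def)
  have comm: "h (p x) = q (h x)" for x
  proof (cases "x \<in> {1..d}")
    case True
    then have px: "p x \<in> {1..d}" using p by (simp del: atLeastAtMost_iff)
    have o: "orbit p (p x) = orbit p x" by (rule permutation_orbit_step[OF permp])
    then have r: "rp (p x) = rp x" "rq (p x) = rq x" by (simp_all add: rp_def rq_def)
    have "(p ^^ k (p x)) (rp x) = (p ^^ Suc (k x)) (rp x)"
      using x_k[of "p x"] x_k[of x] r by simp
    then have "(q ^^ k (p x)) (rq x) = (q ^^ Suc (k x)) (rq x)" using transfer[OF True] by blast
    then show ?thesis using True px r by (simp add: h_def)
  next
    case False
    then have "p x = x" "q x = x" "h x = x"
      using p q by (auto simp: Sym_def permutes_not_in h_def)
    then show ?thesis by simp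
  qed
  then have "h \<circ> p = q \<circ> h" by (simp add: fun_eq_iff)
  then have "q = h \<circ> p \<circ> inv h" using h by simp
  with h show ?thesis by (rule that)
qed

lemma ex_partition_cycle_type:
  assumes p: "p \<in> G"
  shows "\<exists>\<alpha>\<in>partitions_of d. p \<in> conj_class d \<alpha>"
proof -
  define M where "M = cycle_type d p"
  define \<alpha> where "\<alpha> = rev (sorted_list_of_multiset M)"
  have "sum_mset M = (\<Sum>S\<in>orbit p ` {1..d}. card S)"
    by (simp add: M_def cycle_type_def sum_unfold_sum_mset)
  also have "\<dots> = card (\<Union> (orbit p ` {1..d}))"
  proof (rule card_Union_disjoint[symmetric])
    show "disjoint (orbit p ` {1..d})"
    proof (rule disjointI)
      fix S T assume "S \<in> orbit p ` {1..d}" "T \<in> orbit p ` {1..d}" "S \<noteq> T"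
      then show "S \<inter> T = {}" using orbit_eq[OF p] by blast
    qed
    show "finite S" if "S \<in> orbit p ` {1..d}" for S
      using that finite_orbit[OF orbit_self[OF p]] by auto
  qed
  also have "\<Union> (orbit p ` {1..d}) = {1..d}"
    using orbit_self[OF p] orbit_sub[OF p] by blast
  finally have "sum_mset M = d" by simp
  moreover have "0 \<notin># M"
    using finite_orbit[OF orbit_self[OF p]]
    by (auto simp: M_def cycle_type_def orbit_nonempty)
  moreover have mset: "mset \<alpha> = M" by (simp add: \<alpha>_def)
  moreover have "sorted_wrt (\<ge>) \<alpha>" by (simp add: \<alpha>_def sorted_wrt_rev)
  ultimately have "\<alpha> \<in> partitions_of d"
    by (auto simp: partitions_of_def simp flip: sum_mset_sum_list set_mset_mset)
  moreover have "p \<in> conj_class d \<alpha>" using p mset by (simp add: conj_class_def M_def)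
  ultimately show ?thesis by blast
qed

lemma conj_class_G: "p \<in> conj_class d \<alpha> \<Longrightarrow> p \<in> G"
  by (simp add: conj_class_def)

lemma conj_class_sub: "conj_class d \<alpha> \<subseteq> G"
  by (auto simp: conj_class_def)

lemma finite_conj_class [simp]: "finite (conj_class d \<alpha>)"
  by (rule finite_subset[OF conj_class_sub]) simp

lemma conj_class_conj: "g \<in> G \<Longrightarrow> p \<in> G \<Longrightarrow> g \<circ> p \<circ> inv g \<in> conj_class d \<alpha> \<longleftrightarrow> p \<in> conj_class d \<alpha>"
  by (simp add: conj_class_def cycle_type_conj)

lemma conj_class_inv: "p \<in> G \<Longrightarrow> inv p \<in> conj_class d \<alpha> \<longleftrightarrow> p \<in> conj_class d \<alpha>"
  by (simp add: conj_class_def cycle_type_inv)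

lemma conj_classD:
  assumes "p \<in> conj_class d \<alpha>" "q \<in> conj_class d \<alpha>"
  obtains g where "g \<in> G" "q = g \<circ> p \<circ> inv g"
  using cycle_type_eq_imp_conj[of p q] assms by (auto simp: conj_class_def)

definition clsum where "clsum \<alpha> = (\<Sum>p\<in>conj_class d \<alpha>. \<delta> p)"

lemma clsum_app: "clsum \<alpha> p = (if p \<in> conj_class d \<alpha> then 1 else 0)"
  unfolding clsum_def sum_apply_fun \<delta>_app by (simp add: sum.delta')

lemma central_clsum: "central (clsum \<alpha>)"
proof (rule centralI_app)
  show "clsum \<alpha> \<in> A" unfolding clsum_def by (intro A_sum \<delta>_A conj_class_G)
qed (simp add: clsum_app conj_class_conj)

text \<open>The class of all-ones cycle type is \<open>{id}\<close>; through this the second formula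
  of the theorem is a special case of the first.\<close>

lemma clsum_replicate_1: "clsum (replicate d 1) = \<delta> id"
proof -
  have "p \<in> conj_class d (replicate d 1) \<longleftrightarrow> p = id" for p
  proof
    assume p: "p \<in> conj_class d (replicate d 1)"
    show "p = id"
    proof
      fix x
      have pG: "p \<in> G" using p by (rule conj_class_G)
      show "p x = id x"
      proof (cases "x \<in> {1..d}")
        case True
        then have "card (orbit p x) \<in># cycle_type d p"
          by (auto simp: cycle_type_def)
        also have "cycle_type d p = mset (replicate d 1)" using p by (simp add: conj_class_def)
        finally have "card (orbit p x) = 1" by (simp split: if_splits)
        then obtain y where "orbit p x = {y}" by (rule card_1_singletonE)
        then have "orbit p x = {x}" using orbit_self[OF pG, of x] by simp
        then show ?thesis using orbit_eq_singleton_iff[of p x] by simp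
      next
        case False
        then show ?thesis using pG by (simp add: Sym_def permutes_not_in)
      qed
    qed
  next
    assume "p = id"
    have o: "orbit id x = {x}" for x :: nat by (simp add: orbit_eq_singleton_iff)
    have "cycle_type d id = image_mset card (mset_set ((\<lambda>x. {x}) ` {1..d}))"
      by (simp add: cycle_type_def o)
    also have "\<dots> = image_mset (\<lambda>x. 1) (mset_set {1..d})"
      by (subst image_mset_mset_set[symmetric]) (auto simp: image_mset.compositionality o_def One_nat_def)
    also have "\<dots> = mset (replicate d 1)"
      by (simp add: image_mset_const_eq)
    finally show "p \<in> conj_class d (replicate d 1)" using \<open>p = id\<close> by (simp add: conj_class_def)
  qed
  then show ?thesis by (intro ext) (simp add: clsum_app \<delta>_app)
qed

end

section \<open>Traces on the irreducible modules\<close>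

context sym_algebra
begin

lemma mul_minus_left [simp]: "(- x) \<star> z = - (x \<star> z)" and mul_minus_right [simp]: "z \<star> (- x) = - (z \<star> x)"
  using mul_scale_left[of "-1" x z] mul_scale_right[of z "-1" x] by simp_all

lemma card_G: "card G = fact d"
  unfolding Sym_def by (rule card_permutations) auto

section \<open>Orthogonality of Young symmetrizers and spanning sets\<close>

text \<open>The transposition \<open>t\<close> of \<open>x\<close> and \<open>y\<close> is absorbed
  by the left factor and, passed through \<open>g\<close>, becomes a transposition \<open>s\<close>
  absorbed by the right one. One of the two absorptions costs a sign, so the product equals its own
  negative.\<close>

lemma symr_altr_zero:
  assumes k: "k \<le> d" and g: "g \<in> G" and in1: "inv g x \<in> {1..k}" "inv g y \<in> {1..k}"
    and xy: "x \<in> {1..k}" "y \<in> {1..k}" "x \<noteq> y" "f1 x = f1 y" "f2 (inv g x) = f2 (inv g y)"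
  shows "symr k f1 \<star> \<delta> g \<star> altr k f2 = 0" "altr k f1 \<star> \<delta> g \<star> symr k f2 = 0"
proof -
  define t where "t = transpose x y"
  define s where "s = transpose (inv g x) (inv g y)"
  have t: "t \<in> stab k f1" unfolding t_def using xy by (intro transpose_stab)
  have s: "s \<in> stab k f2" unfolding s_def using in1 xy by (intro transpose_stab)
  have tG: "t \<in> G" and sG: "s \<in> G" using s t k stab_G by blast+
  have ne: "inv g x \<noteq> inv g y" using xy(3) g by (metis G_inv_app(2))
  then have sgn: "sign s = -1" "sign t = -1" using xy by (simp_all add: s_def t_def sign_swap_id)
  have tg: "\<delta> t \<star> \<delta> g = \<delta> g \<star> \<delta> s"
    using transpose_comp_eq[OF G_bij[OF g], of x y] g tG sG by (simp add: \<delta>_mul_\<delta> t_def s_def)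
  have self_neg: "u = 0" if "u = - 1 \<cdot> u" for u :: "(nat \<Rightarrow> nat) \<Rightarrow> complex"
  proof
    fix p show "u p = 0 p" using fun_cong[OF that, of p] by (simp add: zero_fun_apply)
  qed
  have "symr k f1 \<star> \<delta> g \<star> altr k f2 = symr k f1 \<star> \<delta> t \<star> \<delta> g \<star> altr k f2"
    using symr_\<delta>[OF k t] by simp
  also have "\<dots> = symr k f1 \<star> \<delta> g \<star> (\<delta> s \<star> altr k f2)"
    using tg by (metis mul_assoc)
  also have "\<dots> = - 1 \<cdot> (symr k f1 \<star> \<delta> g \<star> altr k f2)"
    using \<delta>_altr[OF k s] sgn by simp
  finally show "symr k f1 \<star> \<delta> g \<star> altr k f2 = 0" by (rule self_neg)
  have "altr k f1 \<star> \<delta> g \<star> symr k f2 = altr k f1 \<star> \<delta> g \<star> (\<delta> s \<star> symr k f2)"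
    using \<delta>_symr[OF k s] by simp
  also have "\<dots> = altr k f1 \<star> \<delta> t \<star> \<delta> g \<star> symr k f2"
    using tg by (metis mul_assoc)
  also have "\<dots> = - 1 \<cdot> (altr k f1 \<star> \<delta> g \<star> symr k f2)"
    using altr_\<delta>[OF k t] sgn by simp
  finally show "altr k f1 \<star> \<delta> g \<star> symr k f2 = 0" by (rule self_neg)
qed

lemma sandwich_zero:
  assumes "\<And>g. g \<in> G \<Longrightarrow> u \<star> \<delta> g \<star> v = 0" "y \<in> A"
  shows "u \<star> y \<star> v = 0"
  by (subst A_expand[OF assms(2)]) (simp add: mul_sum_left mul_sum_right assms(1))

text \<open>The product reads \<open>K.a \<star> K.b \<star> y \<star> M.a \<star> M.b\<close>, so
  it vanishes if either the outer pair or the inner pair kills everything put between. If neither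
  did, the columns of \<mu>, moved by some \<open>g\<close>, would separate the rows of \<kappa>,
  and those of \<kappa>, moved by some \<open>h\<close>, the rows of \<mu>. Dominance in both
  directions makes the diagrams equal.\<close>

lemma young_orthogonal:
  assumes "\<kappa> \<in> partitions_of d" "\<mu> \<in> partitions_of d" "\<kappa> \<noteq> \<mu>" "y \<in> A"
  shows "young.c d \<kappa> \<star> y \<star> young.c d \<mu> = 0"
proof -
  interpret K: young d \<kappa> by standard fact
  interpret M: young d \<mu> by standard fact
  have "(\<forall>g\<in>G. K.a \<star> \<delta> g \<star> M.b = 0) \<or> (\<forall>g\<in>G. K.b \<star> \<delta> g \<star> M.a = 0)"
  proof (rule ccontr)
    assume "\<not> ?thesis"
    then obtain g h where g: "g \<in> G" "K.a \<star> \<delta> g \<star> M.b \<noteq> 0" and h: "h \<in> G" "K.b \<star> \<delta> h \<star> M.a \<noteq> 0"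
      by blast
    have "cnt \<kappa> m = cnt \<mu> m" for m
    proof (rule antisym)
      have "card {x \<in> {1..d}. col \<kappa> (h x) < m} \<le> cnt \<mu> m"
      proof (rule M.card_le_cnt)
        fix x y assume xy: "x \<in> {1..d}" "y \<in> {1..d}" "x \<noteq> y" "row \<mu> x = row \<mu> y"
        have "h x \<noteq> h y" using h xy by (metis G_inv_app(1))
        then show "col \<kappa> (h x) \<noteq> col \<kappa> (h y)"
          using symr_altr_zero(2)[OF order_refl h(1), of "h x" "h y" "col \<kappa>" "row \<mu>"] h xy
          by (auto simp: K.b_def M.a_def simp del: atLeastAtMost_iff)
      qed
      then show "cnt \<kappa> m \<le> cnt \<mu> m" using K.cnt_col[OF h(1)] by simp
      have "card {x \<in> {1..d}. col \<mu> (inv g x) < m} \<le> cnt \<kappa> m"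
      proof (rule K.card_le_cnt)
        fix x y assume xy: "x \<in> {1..d}" "y \<in> {1..d}" "x \<noteq> y" "row \<kappa> x = row \<kappa> y"
        then show "col \<mu> (inv g x) \<noteq> col \<mu> (inv g y)"
          using symr_altr_zero(1)[OF order_refl g(1), of x y "row \<kappa>" "col \<mu>"] g
          by (auto simp: K.a_def M.b_def simp del: atLeastAtMost_iff)
      qed
      then show "cnt \<mu> m \<le> cnt \<kappa> m" using M.cnt_col[OF inv_G[OF g(1)]] by simp
    qed
    then show False using cnt_inject assms by blast
  qed
  then show ?thesis
  proof (elim disjE)
    assume 1: "\<forall>g\<in>G. K.a \<star> \<delta> g \<star> M.b = 0"
    have "K.a \<star> (K.b \<star> y \<star> M.a) \<star> M.b = 0" by (rule sandwich_zero) (use 1 in auto)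
    then show ?thesis by (simp add: K.c_eq M.c_eq mul_assoc)
  next
    assume 2: "\<forall>g\<in>G. K.b \<star> \<delta> g \<star> M.a = 0"
    have "K.b \<star> y \<star> M.a = 0" by (rule sandwich_zero) (use 2 assms in auto)
    moreover have "K.c \<star> y \<star> M.c = K.a \<star> (K.b \<star> y \<star> M.a) \<star> M.b" by (simp add: K.c_eq M.c_eq mul_assoc)
    ultimately show ?thesis by simp
  qed
qed

lemma A_span: "A \<subseteq> cfun.span (\<delta> ` G)"
proof
  fix x assume "x \<in> A"
  then have "x = (\<Sum>g\<in>G. x g \<cdot> \<delta> g)" by (rule A_expand)
  also have "\<dots> \<in> cfun.span (\<delta> ` G)"
    by (intro cfun.span_sum cfun.span_scale cfun.span_base) auto
  finally show "x \<in> cfun.span (\<delta> ` G)" .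
qed

lemma some_basis:
  assumes "cfun.subspace V" "V \<subseteq> A"
  shows "some_basis V \<subseteq> V" "cfun.independent (some_basis V)" "cfun.span (some_basis V) = V" "finite (some_basis V)"
proof -
  obtain B where "B \<subseteq> V" "cfun.independent B" "V \<subseteq> cfun.span B"
    using cfun.maximal_independent_subset[of V] by blast
  moreover from this have "cfun.span B = V" using cfun.span_minimal[OF _ assms(1)] by auto
  ultimately have "B \<subseteq> V \<and> cfun.independent B \<and> cfun.span B = V" by simp
  then have "some_basis V \<subseteq> V \<and> cfun.independent (some_basis V) \<and> cfun.span (some_basis V) = V"
    unfolding some_basis_def by (rule someI)
  then show *: "some_basis V \<subseteq> V" "cfun.independent (some_basis V)" "cfun.span (some_basis V) = V" by auto
  show "finite (some_basis V)"
    using cfun.independent_span_bound[of "\<delta> ` G" "some_basis V"] * assms(2) A_span by auto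
qed

text \<open>A central element is constant on conjugacy classes. The sum runs over the set of classes
  instead of over partitions, so that each permutation lies in exactly one summand without comparing
  the partitions themselves.\<close>

lemma conj_classes_cover:
  assumes "central z"
  shows "z \<in> cfun.span (clsum ` partitions_of d)"
proof -
  define KK where "KK = conj_class d ` partitions_of d"
  define ind :: "(nat \<Rightarrow> nat) set \<Rightarrow> (nat \<Rightarrow> nat) \<Rightarrow> complex" where "ind = (\<lambda>K p. if p \<in> K then 1 else 0)"
  have fin: "finite KK"
    by (rule finite_subset[of _ "Pow G"]) (use conj_class_sub in \<open>auto simp: KK_def\<close>)
  have "z = (\<Sum>K\<in>KK. z (SOME g. g \<in> K) \<cdot> ind K)"
  proof (rule A_eqI)
    fix p assume p: "p \<in> G"
    then obtain \<alpha> where \<alpha>: "\<alpha> \<in> partitions_of d" "p \<in> conj_class d \<alpha>" using ex_partition_cycle_type by blast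
    let ?K = "conj_class d \<alpha>"
    have uniq: "K = ?K" if "K \<in> KK" "p \<in> K" for K
      using that \<alpha> by (auto simp: KK_def conj_class_def)
    have "(\<Sum>K\<in>KK. z (SOME g. g \<in> K) \<cdot> ind K) p = (\<Sum>K\<in>KK. z (SOME g. g \<in> K) * ind K p)"
      by (simp add: sum_apply_fun)
    also have "\<dots> = (\<Sum>K\<in>KK. if K = ?K then z (SOME g. g \<in> ?K) else 0)"
    proof (rule sum.cong[OF refl])
      fix K assume K: "K \<in> KK"
      show "z (SOME g. g \<in> K) * ind K p = (if K = ?K then z (SOME g. g \<in> ?K) else 0)"
        using uniq[OF K] \<alpha>(2) by (cases "p \<in> K") (auto simp: ind_def)
    qed
    also have "\<dots> = z (SOME g. g \<in> ?K)"
      using fin \<alpha> by (simp add: sum.delta' KK_def)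
    also have "\<dots> = z p"
    proof -
      have "(SOME g. g \<in> ?K) \<in> ?K" using \<alpha>(2) by (rule someI[of "\<lambda>g. g \<in> ?K"])
      then obtain h where "h \<in> G" "(SOME g. g \<in> ?K) = h \<circ> p \<circ> inv h" using conj_classD[OF \<alpha>(2)] by blast
      then show ?thesis using central_app[OF assms] p by simp
    qed
    finally show "z p = (\<Sum>K\<in>KK. z (SOME g. g \<in> K) \<cdot> ind K) p" by simp
  next
    show "(\<Sum>K\<in>KK. z (SOME g. g \<in> K) \<cdot> ind K) \<in> A"
      using conj_class_G by (intro A_sum A_closed) (auto simp: KK_def ind_def group_algebra_def)
  qed (rule central_A[OF assms])
  also have "\<dots> \<in> cfun.span (clsum ` partitions_of d)"
  proof (intro cfun.span_sum cfun.span_scale cfun.span_base)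
    fix K assume "K \<in> KK"
    then obtain \<alpha> where "\<alpha> \<in> partitions_of d" "K = conj_class d \<alpha>" by (auto simp: KK_def)
    moreover from this have "ind K = clsum \<alpha>" by (simp add: fun_eq_iff ind_def clsum_app)
    ultimately show "ind K \<in> clsum ` partitions_of d" by blast
  qed
  finally show ?thesis .
qed

lemma finite_partitions: "finite (partitions_of d)"
proof (rule finite_subset)
  show "partitions_of d \<subseteq> {xs. set xs \<subseteq> {0..d} \<and> length xs \<le> d}"
  proof
    fix \<nu> assume \<nu>: "\<nu> \<in> partitions_of d"
    then have s: "sum_list \<nu> = d" "0 \<notin> set \<nu>" by (auto simp: partitions_of_def)
    have "set \<nu> \<subseteq> {0..d}" using member_le_sum_list[of _ \<nu>] s by auto
    moreover have "length xs \<le> sum_list xs" if "0 \<notin> set xs" for xs :: "nat list"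
      using that by (induction xs) auto
    ultimately show "\<nu> \<in> {xs. set xs \<subseteq> {0..d} \<and> length xs \<le> d}" using s by auto
  qed
  show "finite {xs. set xs \<subseteq> {0..d} \<and> length xs \<le> d}"
    by (rule finite_lists_length_le) simp
qed

end

section \<open>The module as a left ideal: trace, dimension and character\<close>

context young
begin

abbreviation V where "V \<equiv> irrep d \<nu>"

lemma V_eq: "V = (\<lambda>x. x \<star> c) ` A"
  by (simp add: irrep_def c_def)

lemma V_subspace: "cfun.subspace V"
proof -
  have "x \<star> c + y \<star> c \<in> V" "k \<cdot> (x \<star> c) \<in> V" if "x \<in> A" "y \<in> A" for x y k
    unfolding V_eq using that image_eqI[of "x \<star> c + y \<star> c" "\<lambda>x. x \<star> c" "x + y" A]
     image_eqI[of "k \<cdot> (x \<star> c)" "\<lambda>x. x \<star> c" "k \<cdot> x" A]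
    by (auto simp: mul_add_left)
  moreover have "0 \<in> V" unfolding V_eq by (rule image_eqI[of _ _ 0]) auto
  ultimately show ?thesis unfolding cfun.subspace_def V_eq by auto
qed

lemma V_A: "V \<subseteq> A" by (auto simp: V_eq)

lemma V_mul: "v \<in> V \<Longrightarrow> z \<star> v \<in> V"
  by (auto simp: V_eq mul_assoc[symmetric])

lemma V_c: "v \<in> V \<Longrightarrow> v \<star> c = n \<cdot> v"
  by (auto simp: V_eq mul_assoc c_c)

text \<open>Right multiplication by the Young symmetrizer maps the group algebra to the module and is
  scalar there, so by cyclicity the trace on the module is a trace on the group algebra.\<close>

lemma n_trace: "n * trace_on V (ga_mult d z) = (\<Sum>g\<in>G. (z \<star> \<delta> g \<star> c) g)"
proof -
  define B where "B = some_basis V"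
  have B: "B \<subseteq> V" "cfun.independent B" "cfun.span B = V" "finite B"
    using some_basis[OF V_subspace V_A] by (auto simp: B_def)
  define \<phi> where "\<phi> = cfun.representation B"
  have expand: "v = (\<Sum>b\<in>B. \<phi> v b \<cdot> b)" if "v \<in> V" for v
    unfolding \<phi>_def using cfun.sum_representation_eq[OF B(2) _ B(4) order_refl, of v] that B(3) by simp
  have "(\<Sum>g\<in>G. (z \<star> \<delta> g \<star> c) g) = (\<Sum>g\<in>G. \<Sum>b\<in>B. \<phi> (\<delta> g \<star> c) b * (z \<star> b) g)"
  proof (rule sum.cong[OF refl])
    fix g assume g: "g \<in> G"
    have "\<delta> g \<star> c \<in> V" using g by (auto simp: V_eq)
    from expand[OF this] have "z \<star> (\<delta> g \<star> c) = z \<star> (\<Sum>b\<in>B. \<phi> (\<delta> g \<star> c) b \<cdot> b)" by simp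
    then show "(z \<star> \<delta> g \<star> c) g = (\<Sum>b\<in>B. \<phi> (\<delta> g \<star> c) b * (z \<star> b) g)"
      by (simp add: mul_assoc mul_sum_right sum_apply_fun)
  qed
  \<comment> \<open>Exchanging the sums is the cyclicity: the values \<open>(z \<star> b) g\<close>
    now act as coefficients of the elements \<open>\<delta> g \<star> c\<close> and reassemble to
    \<open>z \<star> b \<star> c\<close>.\<close>
  also have "\<dots> = (\<Sum>b\<in>B. \<Sum>g\<in>G. (z \<star> b) g * \<phi> (\<delta> g \<star> c) b)"
    by (subst sum.swap) (simp add: mult.commute)
  also have "\<dots> = (\<Sum>b\<in>B. n * \<phi> (z \<star> b) b)"
  proof (rule sum.cong[OF refl])
    fix b assume b: "b \<in> B"
    have inV: "\<delta> g \<star> c \<in> V" if "g \<in> G" for g using that by (auto simp: V_eq)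
    have zb: "z \<star> b \<in> V" using b B V_mul by blast
    have "(\<Sum>g\<in>G. (z \<star> b) g * \<phi> (\<delta> g \<star> c) b) = (\<Sum>g\<in>G. \<phi> ((z \<star> b) g \<cdot> (\<delta> g \<star> c)) b)"
      unfolding \<phi>_def using inV B(3)
      by (intro sum.cong refl) (simp add: cfun.representation_scale[OF B(2)])
    also have "\<dots> = \<phi> (\<Sum>g\<in>G. (z \<star> b) g \<cdot> (\<delta> g \<star> c)) b"
      unfolding \<phi>_def using inV B(3) cfun.subspace_scale[OF V_subspace]
      by (subst cfun.representation_sum[OF B(2)]) auto
    also have "(\<Sum>g\<in>G. (z \<star> b) g \<cdot> (\<delta> g \<star> c)) = (z \<star> b) \<star> c"
      by (subst (2) A_expand[OF mul_A]) (simp add: mul_sum_left)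
    also have "\<dots> = n \<cdot> (z \<star> b)" by (rule V_c[OF zb])
    also have "\<phi> (n \<cdot> (z \<star> b)) b = n * \<phi> (z \<star> b) b"
      unfolding \<phi>_def using zb B(3) by (simp add: cfun.representation_scale[OF B(2)])
    finally show "(\<Sum>g\<in>G. (z \<star> b) g * \<phi> (\<delta> g \<star> c) b) = n * \<phi> (z \<star> b) b" .
  qed
  also have "\<dots> = n * trace_on V (ga_mult d z)"
    by (simp add: trace_on_def B_def \<phi>_def sum_distrib_left)
  finally show ?thesis by simp
qed

lemma \<delta>_c_diag: "g \<in> G \<Longrightarrow> (\<delta> g \<star> c) g = 1"
  by (simp add: \<delta>_mul_app c_id)

lemma trace_id: "trace_on V (ga_mult d (\<delta> id)) = of_nat (dim_irrep d \<nu>)"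
proof -
  define B where "B = some_basis V"
  have B: "B \<subseteq> V" "cfun.independent B" "cfun.span B = V" "finite B"
    using some_basis[OF V_subspace V_A] by (auto simp: B_def)
  have "trace_on V (ga_mult d (\<delta> id)) = (\<Sum>b\<in>B. 1)"
    unfolding trace_on_def B_def[symmetric]
    by (intro sum.cong refl) (use B V_A in \<open>auto simp: cfun.representation_basis\<close>)
  moreover have "card B = dim_irrep d \<nu>"
    unfolding dim_irrep_def using B cfun.dim_eq_card[of B V] cfun.span_span[of B] by metis
  ultimately show ?thesis by simp
qed

text \<open>The trace formula at the identity: each of the d! diagonal terms is
  \<open>c id = 1\<close>. It also shows that \<open>n\<close> and the dimension are
  nonzero.\<close>

lemma n_dim: "n * of_nat (dim_irrep d \<nu>) = fact d"
proof -
  have "n * of_nat (dim_irrep d \<nu>) = (\<Sum>g\<in>G. (\<delta> id \<star> \<delta> g \<star> c) g)"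
    unfolding trace_id[symmetric] by (rule n_trace)
  also have "\<dots> = (\<Sum>g\<in>G. 1)" by (intro sum.cong refl) (simp add: \<delta>_c_diag)
  finally show ?thesis by (simp add: card_G)
qed

lemma n_nonzero: "n \<noteq> 0" and dim_nonzero: "dim_irrep d \<nu> \<noteq> 0"
  using n_dim by (auto intro: ccontr)

text \<open>Writes the character as a sum of \<open>c\<close> over conjugates of
  \<open>inv g\<close>, a form in which being a class function is a reindexing.\<close>

lemma character_eq:
  assumes g: "g \<in> G"
  shows "n * irrep_character d \<nu> g = (\<Sum>h\<in>G. c (inv h \<circ> inv g \<circ> h))"
  unfolding irrep_character_def n_trace
  using g by (intro sum.cong refl) (simp add: mul_assoc \<delta>_mul_app o_assoc)

lemma character_conj:
  assumes g: "g \<in> G" and k: "k \<in> G"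
  shows "irrep_character d \<nu> (k \<circ> g \<circ> inv k) = irrep_character d \<nu> g"
proof -
  have "n * irrep_character d \<nu> (k \<circ> g \<circ> inv k) = (\<Sum>h\<in>G. c (inv h \<circ> inv (k \<circ> g \<circ> inv k) \<circ> h))"
    using g k by (intro character_eq) simp
  also have "\<dots> = (\<Sum>h\<in>G. c (inv (k \<circ> h) \<circ> inv (k \<circ> g \<circ> inv k) \<circ> (k \<circ> h)))"
    by (rule sum_comp_left[OF k, symmetric])
  also have "\<dots> = (\<Sum>h\<in>G. c (inv h \<circ> inv g \<circ> h))"
  proof (intro sum.cong refl arg_cong[of _ _ c])
    fix h assume h: "h \<in> G"
    show "inv (k \<circ> h) \<circ> inv (k \<circ> g \<circ> inv k) \<circ> (k \<circ> h) = inv h \<circ> inv g \<circ> h"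
      using g k h by (simp add: G_inv_comp fun_eq_iff)
  qed
  also have "\<dots> = n * irrep_character d \<nu> g" by (rule character_eq[OF g, symmetric])
  finally show ?thesis using n_nonzero by simp
qed

text \<open>The trace of the class sum is computed twice: as class size times character value, and
  as scalar times dimension, because the central class sum passes \<open>\<delta> h\<close> and acts
  on \<open>c\<close> by \<open>om\<close>.\<close>

lemma omega_eq: "omega d \<alpha> \<nu> = om (clsum \<alpha>)"
proof -
  let ?K = "conj_class d \<alpha>"
  have chi: "irrep_character d \<nu> g = chi d \<alpha> \<nu>" if g: "g \<in> ?K" for g
  proof -
    have "(SOME g. g \<in> ?K) \<in> ?K" using g by (rule someI[of "\<lambda>g. g \<in> ?K"])
    then obtain k where "k \<in> G" "(SOME g. g \<in> ?K) = k \<circ> g \<circ> inv k" using conj_classD[OF g] by blast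
    then show ?thesis unfolding chi_def using character_conj[OF conj_class_G[OF g]] by simp
  qed
  have "n * (of_nat (card ?K) * chi d \<alpha> \<nu>) = (\<Sum>g\<in>?K. n * irrep_character d \<nu> g)"
    by (simp add: chi)
  also have "\<dots> = (\<Sum>g\<in>?K. \<Sum>h\<in>G. (\<delta> g \<star> \<delta> h \<star> c) h)"
    by (simp add: irrep_character_def n_trace)
  also have "\<dots> = (\<Sum>h\<in>G. (clsum \<alpha> \<star> \<delta> h \<star> c) h)"
    unfolding clsum_def by (subst sum.swap) (simp add: mul_sum_left sum_apply_fun)
  also have "\<dots> = (\<Sum>h\<in>G. om (clsum \<alpha>))"
  proof (intro sum.cong refl)
    fix h assume h: "h \<in> G"
    have "clsum \<alpha> \<star> \<delta> h \<star> c = \<delta> h \<star> (clsum \<alpha> \<star> c)"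
      using central_clsum[of \<alpha>] h by (simp add: central_def mul_assoc[symmetric])
    also have "\<dots> = om (clsum \<alpha>) \<cdot> (\<delta> h \<star> c)" by (simp add: central_c[OF central_clsum])
    finally show "(clsum \<alpha> \<star> \<delta> h \<star> c) h = om (clsum \<alpha>)" using h by (simp add: \<delta>_c_diag)
  qed
  also have "\<dots> = fact d * om (clsum \<alpha>)" by (simp add: card_G)
  finally have "of_nat (card ?K) * chi d \<alpha> \<nu> = of_nat (dim_irrep d \<nu>) * om (clsum \<alpha>)"
    unfolding n_dim[symmetric] using n_nonzero by simp
  then show ?thesis unfolding omega_def using dim_nonzero by simp
qed

section \<open>Symmetrized Young symmetrizers and the Plancherel average\<close>

text \<open>Up to the factor \<open>n\<^sup>2\<close> this is the central idempotent of the
  module.\<close>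

definition E where "E = (\<Sum>g\<in>G. \<delta> g \<star> c \<star> \<delta> (inv g))"

lemma E_A [simp]: "E \<in> A"
  unfolding E_def by (intro A_sum mul_A)

lemma central_E: "central E"
proof (rule centralI_app[OF E_A])
  fix g p assume g: "g \<in> G" and p: "p \<in> G"
  have "E (g \<circ> p \<circ> inv g) = (\<Sum>h\<in>G. c (inv h \<circ> (g \<circ> p \<circ> inv g) \<circ> h))"
    unfolding E_def sum_apply_fun using g p by (intro sum.cong refl conj_app) auto
  also have "\<dots> = (\<Sum>h\<in>G. c (inv (g \<circ> h) \<circ> (g \<circ> p \<circ> inv g) \<circ> (g \<circ> h)))"
    by (rule sum_comp_left[OF g, symmetric])
  also have "\<dots> = (\<Sum>h\<in>G. c (inv h \<circ> p \<circ> h))"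
    by (intro sum.cong refl arg_cong[of _ _ c]) (use g p in \<open>simp add: G_inv_comp fun_eq_iff\<close>)
  also have "\<dots> = E p"
    unfolding E_def sum_apply_fun using p by (intro sum.cong refl conj_app[symmetric]) auto
  finally show "E (g \<circ> p \<circ> inv g) = E p" .
qed

lemma E_id: "E id = fact d"
proof -
  have "E id = (\<Sum>g\<in>G. 1)"
    unfolding E_def sum_apply_fun by (intro sum.cong refl) (simp add: conj_app c_id)
  then show ?thesis by (simp add: card_G)
qed

text \<open>Each \<open>c \<star> \<delta> (inv g) \<star> c\<close> is a multiple of
  \<open>c\<close>, so the term of \<open>g\<close> contributes that multiple times
  \<open>c (inv g)\<close>.\<close>

lemma om_E: "om E = n\<^sup>2"
proof -
  have "om E = (\<Sum>g\<in>G. (\<delta> g \<star> (c \<star> \<delta> (inv g) \<star> c)) id)"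
    unfolding om_def E_def by (simp add: mul_sum_left sum_apply_fun mul_assoc)
  also have "\<dots> = (\<Sum>g\<in>G. (c \<star> \<delta> (inv g) \<star> c) id * c (inv g))"
  proof (rule sum.cong[OF refl])
    fix g assume g: "g \<in> G"
    have "\<delta> g \<star> (c \<star> \<delta> (inv g) \<star> c) = (c \<star> \<delta> (inv g) \<star> c) id \<cdot> (\<delta> g \<star> c)"
      by (subst c_mul_c) simp
    then show "(\<delta> g \<star> (c \<star> \<delta> (inv g) \<star> c)) id = (c \<star> \<delta> (inv g) \<star> c) id * c (inv g)"
      using g by (simp add: \<delta>_mul_app)
  qed
  also have "\<dots> = (\<Sum>g\<in>G. (c \<star> \<delta> g \<star> c) id * c g)" by (rule sum_inv_G)
  \<comment> \<open>The weights \<open>c g\<close> turn the sum over group elements back into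
    \<open>c\<close>, leaving its cube.\<close>
  also have "\<dots> = (c \<star> (\<Sum>g\<in>G. c g \<cdot> \<delta> g) \<star> c) id"
    by (simp add: mul_sum_left mul_sum_right sum_apply_fun mult.commute)
  also have "\<dots> = (c \<star> c \<star> c) id" by (simp flip: A_expand)
  also have "\<dots> = n\<^sup>2" by (simp add: c_c c_id power2_eq_square)
  finally show ?thesis .
qed

end

context sym_algebra
begin

lemma om_E_other:
  assumes "\<kappa> \<in> partitions_of d" "\<mu> \<in> partitions_of d" "\<kappa> \<noteq> \<mu>"
  shows "young.om d \<mu> (young.E d \<kappa>) = 0"
proof -
  interpret K: young d \<kappa> by standard fact
  interpret M: young d \<mu> by standard fact
  have "K.E \<star> M.c = (\<Sum>g\<in>G. \<delta> g \<star> (K.c \<star> \<delta> (inv g) \<star> M.c))"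
    unfolding K.E_def by (simp add: mul_sum_left mul_assoc)
  also have "\<dots> = 0" using young_orthogonal[OF assms] by (simp add: sum.neutral)
  finally show ?thesis by (simp add: M.om_def zero_fun_apply)
qed

lemma om_E_cases:
  assumes "\<kappa> \<in> partitions_of d" "\<mu> \<in> partitions_of d"
  shows "young.om d \<mu> (young.E d \<kappa>) = (if \<kappa> = \<mu> then (young.n d \<mu>)\<^sup>2 else 0)"
  using om_E_other[OF assms] young.om_E[of d \<mu>] assms(2) by (auto simp: young_def)

text \<open>The functionals \<open>om\<close> form, up to the nonzero factors
  \<open>n\<^sup>2\<close>, a dual system to the elements \<open>E\<close>, whence injectivity of
  the indexing and independence. Spanning follows by exchange against the class sums.\<close>

lemma central_span_E:
  assumes "central z"
  shows "z \<in> cfun.span (young.E d ` partitions_of d)"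
proof -
  let ?P = "partitions_of d" and ?E = "young.E d"
  let ?B = "?E ` ?P" and ?S = "clsum ` ?P"
  have Y: "young d \<nu>" if "\<nu> \<in> ?P" for \<nu> using that by unfold_locales
  have nz: "young.n d \<mu> \<noteq> 0" if "\<mu> \<in> ?P" for \<mu> using young.n_nonzero[OF Y[OF that]] .
  have inj: "inj_on ?E ?P"
  proof (rule inj_onI)
    fix \<kappa> \<mu> assume "\<kappa> \<in> ?P" "\<mu> \<in> ?P" "?E \<kappa> = ?E \<mu>"
    then show "\<kappa> = \<mu>" using om_E_cases[of \<kappa> \<mu>] om_E_cases[of \<mu> \<mu>] nz[of \<mu>] by (auto split: if_splits)
  qed
  have ind: "cfun.independent ?B"
  proof (rule cfun.independent_if_scalars_zero)
    show "finite ?B" using finite_partitions by simp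
    fix f x assume sum0: "(\<Sum>x\<in>?B. f x \<cdot> x) = 0" and "x \<in> ?B"
    then obtain \<mu> where \<mu>: "\<mu> \<in> ?P" "x = ?E \<mu>" by auto
    interpret M: young d \<mu> by (rule Y[OF \<mu>(1)])
    have "0 = M.om (\<Sum>\<kappa>\<in>?P. f (?E \<kappa>) \<cdot> ?E \<kappa>)"
      using sum0 by (simp add: sum.reindex[OF inj] M.om_def zero_fun_apply)
    also have "\<dots> = (\<Sum>\<kappa>\<in>?P. f (?E \<kappa>) * M.om (?E \<kappa>))"
      by (simp add: M.om_def mul_sum_left sum_apply_fun)
    also have "\<dots> = (\<Sum>\<kappa>\<in>?P. if \<kappa> = \<mu> then f x * M.n\<^sup>2 else 0)"
      using \<mu> by (intro sum.cong refl) (simp add: om_E_cases)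
    also have "\<dots> = f x * M.n\<^sup>2" using \<mu> finite_partitions by (simp add: sum.delta')
    finally show "f x = 0" using M.n_nonzero by simp
  qed
  have cardB: "card ?B = card ?P" by (rule card_image[OF inj])
  have Bspan: "?B \<subseteq> cfun.span ?S"
    using conj_classes_cover young.central_E Y by blast
  have finS: "finite ?S" using finite_partitions by simp
  have "?S \<subseteq> cfun.span ?B"
  proof (rule ccontr)
    assume "\<not> ?S \<subseteq> cfun.span ?B"
    then obtain s where s: "s \<in> ?S" "s \<notin> cfun.span ?B" by auto
    \<comment> \<open>One more independent element would exceed the number of class sums, which is
      at most \<open>card ?P\<close>.\<close>
    have "cfun.independent (insert s ?B)" using ind s by (simp add: cfun.independent_insert)
    moreover have "insert s ?B \<subseteq> cfun.span ?S" using Bspan s by (auto intro: cfun.span_base)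
    ultimately have "card (insert s ?B) \<le> card ?S" using cfun.independent_span_bound[OF finS] by blast
    also have "\<dots> \<le> card ?P" using finite_partitions by (rule card_image_le)
    finally have "card (insert s ?B) \<le> card ?B" using cardB by simp
    moreover have "s \<notin> ?B" using s cfun.span_base by blast
    ultimately show False using finite_partitions by simp
  qed
  then have "cfun.span ?S \<subseteq> cfun.span ?B" by (rule cfun.span_minimal) (rule cfun.subspace_span)
  then show ?thesis using conj_classes_cover[OF assms] by blast
qed

text \<open>Both sides are linear in \<open>z\<close>, so the spanning elements \<open>E\<close>
  suffice. On them only one diagram contributes, and \<open>n\<close> times the dimension being d!
  gives d! on the left, the value of \<open>E id\<close>.\<close>

theorem plancherel_om:
  assumes "central z"
  shows "plancherel_expectation d (\<lambda>\<nu>. young.om d \<nu> z) = z id"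
proof -
  let ?P = "partitions_of d" and ?E = "young.E d"
  define L where "L = (\<lambda>z. \<Sum>\<nu>\<in>?P. young.om d \<nu> z * (of_nat (dim_irrep d \<nu>))\<^sup>2 / fact d)"
  have Y: "young d \<nu>" if "\<nu> \<in> ?P" for \<nu> using that by unfold_locales
  have "L (x + y) = L x + L y" for x y
    unfolding L_def sum.distrib[symmetric]
    by (intro sum.cong refl) (simp add: young.om_add[OF Y] algebra_simps add_divide_distrib)
  moreover have "L (k \<cdot> x) = k * L x" for k x
    unfolding L_def sum_distrib_left
    by (intro sum.cong refl) (simp add: young.om_scale[OF Y])
  moreover from this[of 0 0] have "L 0 = 0" by simp
  ultimately have "cfun.subspace {z. L z = z id}"
    by (simp add: cfun.subspace_def plus_fun_apply zero_fun_apply)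
  moreover have "?E ` ?P \<subseteq> {z. L z = z id}"
  proof clarify
    fix \<mu> assume \<mu>: "\<mu> \<in> ?P"
    interpret M: young d \<mu> by (rule Y[OF \<mu>])
    have "L (?E \<mu>) = (\<Sum>\<nu>\<in>?P. if \<nu> = \<mu> then M.n\<^sup>2 * (of_nat (dim_irrep d \<mu>))\<^sup>2 / fact d else 0)"
      unfolding L_def using \<mu> by (intro sum.cong refl) (auto simp: om_E_cases)
    also have "\<dots> = (M.n * of_nat (dim_irrep d \<mu>))\<^sup>2 / fact d"
      using \<mu> finite_partitions by (simp add: sum.delta' power_mult_distrib)
    also have "\<dots> = ?E \<mu> id" unfolding M.n_dim M.E_id by (simp add: power2_eq_square)
    finally show "L (?E \<mu>) = ?E \<mu> id" .
  qed
  ultimately have "cfun.span (?E ` ?P) \<subseteq> {z. L z = z id}" by (intro cfun.span_minimal)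
  then show ?thesis using central_span_E[OF assms] by (auto simp: plancherel_expectation_def L_def)
qed

end

section \<open>The action of the Jucys--Murphy elements\<close>

context young
begin

definition cont :: "nat \<Rightarrow> complex" where
  "cont x = of_int (content (row \<nu> x, col \<nu> x))"

text \<open>In the row-by-row tableau the smaller entries in the row of \<open>K\<close> lie to its
  left, and those in its column lie above it (\<open>card_same_col\<close>). As coordinates start at
  0, the two counts are the coordinates of the cell, and their difference is its content.\<close>

lemma card_same_row:
  assumes K: "K \<in> {1..d}"
  shows "card {m \<in> {1..<K}. row \<nu> m = row \<nu> K} = col \<nu> K"
proof -
  have "bij_betw (col \<nu>) {m \<in> {1..<K}. row \<nu> m = row \<nu> K} {..<col \<nu> K}"
  proof (rule bij_betwI[where g = "\<lambda>j. tableau \<nu> (row \<nu> K, j)"])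
    show "col \<nu> \<in> {m \<in> {1..<K}. row \<nu> m = row \<nu> K} \<rightarrow> {..<col \<nu> K}"
    proof
      fix m assume "m \<in> {m \<in> {1..<K}. row \<nu> m = row \<nu> K}"
      then have m: "m \<in> {1..d}" "m < K" "row \<nu> m = row \<nu> K" using K by auto
      then show "col \<nu> m \<in> {..<col \<nu> K}" using col_lt[OF m(1) K m(3)] by simp
    qed
    show "(\<lambda>j. tableau \<nu> (row \<nu> K, j)) \<in> {..<col \<nu> K} \<rightarrow> {m \<in> {1..<K}. row \<nu> m = row \<nu> K}"
    proof
      fix j assume "j \<in> {..<col \<nu> K}"
      then have j: "j < col \<nu> K" by simp
      have cell: "(row \<nu> K, j) \<in> cells \<nu>" using cells_down[OF \<nu> cell[OF K]] j by simp
      show "tableau \<nu> (row \<nu> K, j) \<in> {m \<in> {1..<K}. row \<nu> m = row \<nu> K}"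
        using col_lt[OF tableau_range[OF cell] K] tableau_range[OF cell] cell j by auto
    qed
    show "tableau \<nu> (row \<nu> K, col \<nu> x) = x" if "x \<in> {m \<in> {1..<K}. row \<nu> m = row \<nu> K}" for x
      using that tableau_cell[of x] K by auto
    show "col \<nu> (tableau \<nu> (row \<nu> K, j)) = j" if "j \<in> {..<col \<nu> K}" for j
      using cells_down[OF \<nu> cell[OF K]] that by simp
  qed
  then show ?thesis using bij_betw_same_card by fastforce
qed

lemma card_same_col:
  assumes K: "K \<in> {1..d}"
  shows "card {m \<in> {1..<K}. col \<nu> m = col \<nu> K} = row \<nu> K"
proof -
  have "bij_betw (row \<nu>) {m \<in> {1..<K}. col \<nu> m = col \<nu> K} {..<row \<nu> K}"
  proof (rule bij_betwI[where g = "\<lambda>i. tableau \<nu> (i, col \<nu> K)"])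
    show "row \<nu> \<in> {m \<in> {1..<K}. col \<nu> m = col \<nu> K} \<rightarrow> {..<row \<nu> K}"
    proof
      fix m assume "m \<in> {m \<in> {1..<K}. col \<nu> m = col \<nu> K}"
      then have m: "m \<in> {1..d}" "m < K" "col \<nu> m = col \<nu> K" using K by auto
      then have "row \<nu> m \<le> row \<nu> K" "row \<nu> m \<noteq> row \<nu> K"
        using row_mono[OF m(1) K] row_col_inj[OF m(1) K] by auto
      then show "row \<nu> m \<in> {..<row \<nu> K}" by simp
    qed
    show "(\<lambda>i. tableau \<nu> (i, col \<nu> K)) \<in> {..<row \<nu> K} \<rightarrow> {m \<in> {1..<K}. col \<nu> m = col \<nu> K}"
    proof
      fix i assume "i \<in> {..<row \<nu> K}"
      then have i: "i < row \<nu> K" by simp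
      have cell: "(i, col \<nu> K) \<in> cells \<nu>" using cells_down[OF \<nu> cell[OF K]] i by simp
      show "tableau \<nu> (i, col \<nu> K) \<in> {m \<in> {1..<K}. col \<nu> m = col \<nu> K}"
        using row_lt[OF tableau_range[OF cell] K] tableau_range[OF cell] cell i by auto
    qed
    show "tableau \<nu> (row \<nu> x, col \<nu> K) = x" if "x \<in> {m \<in> {1..<K}. col \<nu> m = col \<nu> K}" for x
      using that tableau_cell[of x] K by auto
    show "row \<nu> (tableau \<nu> (i, col \<nu> K)) = i" if "i \<in> {..<row \<nu> K}" for i
      using cells_down[OF \<nu> cell[OF K]] that by simp
  qed
  then show ?thesis using bij_betw_same_card by fastforce
qed

text \<open>In a common row the transposition is absorbed by the symmetrizer, in a common column by
  the antisymmetrizer with a sign. Otherwise a corner \<open>e\<close> of the rectangle spanned by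
  the cells of \<open>m\<close> and \<open>K\<close> forces the product to vanish.\<close>

lemma symr_transpose_altr:
  assumes K: "K \<in> {1..d}" and m: "m \<in> {1..<K}"
  shows "symr K (row \<nu>) \<star> \<delta> (transpose m K) \<star> altr K (col \<nu>)
    = ((if row \<nu> m = row \<nu> K then 1 else 0) - (if col \<nu> m = col \<nu> K then 1 else 0)) \<cdot> (symr K (row \<nu>) \<star> altr K (col \<nu>))"
    (is "?a \<star> \<delta> ?t \<star> ?b = ?r \<cdot> _")
proof -
  have K': "K \<le> d" "K \<in> {1..K}" and m': "m \<in> {1..K}" "m \<in> {1..d}" "m \<noteq> K" "m < K" using K m by auto
  have tG: "?t \<in> G" using K m' by simp
  have tinv: "inv ?t = ?t" by simp
  consider "row \<nu> m = row \<nu> K" | "col \<nu> m = col \<nu> K" |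
     "row \<nu> m \<noteq> row \<nu> K" "col \<nu> m < col \<nu> K" | "row \<nu> m \<noteq> row \<nu> K" "col \<nu> K < col \<nu> m" by linarith
  then show ?thesis
  proof cases
    case 1
    then have "col \<nu> m \<noteq> col \<nu> K" using row_col_inj[OF m'(2) K] m' by auto
    moreover have "?t \<in> stab K (row \<nu>)" using 1 K' m' by (intro transpose_stab)
    ultimately show ?thesis using 1 by (simp add: symr_\<delta>[OF K'(1)])
  next
    case 2
    then have "row \<nu> m \<noteq> row \<nu> K" using row_col_inj[OF m'(2) K] m' by auto
    moreover have "?t \<in> stab K (col \<nu>)" using 2 K' m' by (intro transpose_stab)
    ultimately show ?thesis using 2 m' by (simp add: mul_assoc \<delta>_altr[OF K'(1)] sign_swap_id)
  next
    case 3
    \<comment> \<open>The corner left of \<open>K\<close>: it is in the row of \<open>K\<close>, and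
      in the column of \<open>m\<close>, the image of \<open>K\<close> under the transposition.
      Being smaller than \<open>K\<close>, it lies within the cutoff.\<close>
    define e where "e = tableau \<nu> (row \<nu> K, col \<nu> m)"
    have cell: "(row \<nu> K, col \<nu> m) \<in> cells \<nu>" using cells_down[OF \<nu> cell[OF K]] 3 by simp
    have e: "e \<in> {1..d}" "row \<nu> e = row \<nu> K" "col \<nu> e = col \<nu> m"
      using cell tableau_range[OF cell] by (auto simp: e_def)
    have eK: "e < K" "e \<noteq> m" using col_lt[OF e(1) K] e 3 by auto
    have "?a \<star> \<delta> ?t \<star> ?b = 0"
      by (rule symr_altr_zero(1)[OF K'(1) tG, of e K]) (use eK e K' m' in auto)
    then show ?thesis using 3 by simp
  next
    case 4
    \<comment> \<open>The mirror case: \<open>e\<close> is left of \<open>m\<close> in its row and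
      shares a column with \<open>K\<close>, the image of \<open>m\<close>.\<close>
    define e where "e = tableau \<nu> (row \<nu> m, col \<nu> K)"
    have cell: "(row \<nu> m, col \<nu> K) \<in> cells \<nu>" using cells_down[OF \<nu> cell[OF m'(2)]] 4 by simp
    have e: "e \<in> {1..d}" "row \<nu> e = row \<nu> m" "col \<nu> e = col \<nu> K"
      using cell tableau_range[OF cell] by (auto simp: e_def)
    have eK: "e < m" "e \<noteq> K" using col_lt[OF e(1) m'(2)] e 4 by auto
    have "?a \<star> \<delta> ?t \<star> ?b = 0"
      by (rule symr_altr_zero(1)[OF K'(1) tG, of e m]) (use eK e K' m' in auto)
    then show ?thesis using 4 by simp
  qed
qed

lemma symr_JM_altr:
  assumes K: "K \<in> {1..d}"
  shows "symr K (row \<nu>) \<star> JM K \<star> altr K (col \<nu>) = cont K \<cdot> (symr K (row \<nu>) \<star> altr K (col \<nu>))"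
proof -
  let ?a = "symr K (row \<nu>)" and ?b = "altr K (col \<nu>)"
  have "?a \<star> JM K \<star> ?b = (\<Sum>m\<in>{1..<K}. ?a \<star> \<delta> (transpose m K) \<star> ?b)"
    by (simp add: JM_def mul_sum_left mul_sum_right)
  also have "\<dots> = (\<Sum>m\<in>{1..<K}. ((if row \<nu> m = row \<nu> K then 1 else 0) - (if col \<nu> m = col \<nu> K then 1 else 0)) \<cdot> (?a \<star> ?b))"
    by (intro sum.cong refl symr_transpose_altr[OF K])
  also have "\<dots> = (\<Sum>m\<in>{1..<K}. (if row \<nu> m = row \<nu> K then 1 else 0) - (if col \<nu> m = col \<nu> K then 1 else 0)) \<cdot> (?a \<star> ?b)"
    by (rule cfun.scale_sum_left[symmetric])
  also have "(\<Sum>m\<in>{1..<K}. (if row \<nu> m = row \<nu> K then 1 else 0) - (if col \<nu> m = col \<nu> K then 1 else 0))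
     = of_nat (card {m \<in> {1..<K}. row \<nu> m = row \<nu> K}) - (of_nat (card {m \<in> {1..<K}. col \<nu> m = col \<nu> K}) :: complex)"
    unfolding sum_subtractf sum.inter_filter[OF finite_atLeastLessThan, symmetric] by simp
  also have "\<dots> = cont K"
    unfolding card_same_row[OF K] card_same_col[OF K] by (simp add: cont_def content_def)
  finally show ?thesis .
qed

text \<open>The larger symmetrizers have the smaller ones as inner factors. The last factor
  \<open>Y\<close> commutes with the smaller antisymmetrizer, which involves only permutations of
  \<open>{1..k}\<close>; moving it past exposes the product of the induction hypothesis. Moved back,
  \<open>Y\<close> meets the larger symmetrizers and yields the content of the last cell.\<close>

lemma symr_prodJ_altr:
  "k \<le> d \<Longrightarrow> symr k (row \<nu>) \<star> prodJ t k \<star> altr k (col \<nu>)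
     = (\<Prod>x\<in>{1..k}. 1 + t * cont x) \<cdot> (symr k (row \<nu>) \<star> altr k (col \<nu>))"
proof (induction k)
  case 0
  then show ?case by simp
next
  case (Suc k)
  define K where "K = Suc k"
  have k: "k \<le> d" "K \<in> {1..d}" "Suc k \<le> d" using Suc.prems by (auto simp: K_def)
  define Y where "Y = \<delta> id + t \<cdot> JM K"
  define P where "P = prodJ t k"
  define ak where "ak = symr k (row \<nu>)"
  define bk where "bk = altr k (col \<nu>)"
  define aK where "aK = symr K (row \<nu>)"
  define bK where "bK = altr K (col \<nu>)"
  obtain a' b' where a': "aK = a' \<star> ak" and b': "bK = bk \<star> b'"
    unfolding aK_def bK_def ak_def bk_def K_def symr_Suc[OF k(3)] altr_Suc[OF k(3)] by blast
  have bA: "bk \<in> A" "aK \<in> A" using k by (auto simp: bk_def aK_def)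
  have Yb: "Y \<star> bk = bk \<star> Y"
    unfolding Y_def using supp_JM_commute[OF supp_altr[OF k(1), of "col \<nu>"] k(3)] bA
    by (simp add: mul_add_left mul_add_right bk_def K_def)
  have IH: "ak \<star> P \<star> bk = (\<Prod>x\<in>{1..k}. 1 + t * cont x) \<cdot> (ak \<star> bk)"
    unfolding ak_def bk_def P_def by (rule Suc.IH[OF k(1)])
  have "aK \<star> (P \<star> Y) \<star> bK = a' \<star> ak \<star> P \<star> (Y \<star> bk) \<star> b'"
    by (simp add: a' b' mul_assoc)
  also have "\<dots> = a' \<star> (ak \<star> P \<star> bk) \<star> Y \<star> b'" unfolding Yb by (simp add: mul_assoc)
  also have "\<dots> = (\<Prod>x\<in>{1..k}. 1 + t * cont x) \<cdot> (a' \<star> ak \<star> (bk \<star> Y) \<star> b')"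
    unfolding IH by (simp add: mul_assoc)
  also have "a' \<star> ak \<star> (bk \<star> Y) \<star> b' = aK \<star> Y \<star> bK"
    unfolding Yb[symmetric] by (simp add: a' b' mul_assoc)
  also have "aK \<star> Y \<star> bK = (1 + t * cont K) \<cdot> (aK \<star> bK)"
    unfolding Y_def using symr_JM_altr[OF k(2)] bA
    by (simp add: mul_add_left mul_add_right cfun.scale_left_distrib aK_def bK_def)
  finally have "aK \<star> (P \<star> Y) \<star> bK = ((\<Prod>x\<in>{1..k}. 1 + t * cont x) * (1 + t * cont K)) \<cdot> (aK \<star> bK)"
    by (simp only: cfun.scale_scale)
  then show ?case by (simp add: aK_def bK_def P_def Y_def K_def mult.commute del: scale_fun_apply)
qed

text \<open>Centrality carries the product past the row symmetrizer to its place between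
  \<open>a\<close> and \<open>b\<close>, where the induction evaluates it.\<close>

lemma om_prodJ: "om (prodJ t d) = (\<Prod>x\<in>{1..d}. 1 + t * cont x)"
proof -
  have "prodJ t d \<star> c = a \<star> prodJ t d \<star> b"
    unfolding c_eq using central_commute[OF central_prodJ a_A] by (simp add: mul_assoc[symmetric])
  also have "\<dots> = (\<Prod>x\<in>{1..d}. 1 + t * cont x) \<cdot> c"
    unfolding a_def b_def c_eq by (rule symr_prodJ_altr) simp
  finally show ?thesis by (simp add: om_def c_id)
qed

lemma Omega_eq: "Omega N \<nu> = om (prodJ (1 / of_nat N) d)"
  unfolding Omega_def om_prodJ
  by (subst prod.reindex_bij_betw[OF bij_cell, symmetric]) (simp add: cont_def)

end

section \<open>Monotone walks\<close>

text \<open>The step sequences of monotone walks, detached from the starting point and bounded by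
  \<open>k\<close> so that induction on the largest entry is possible.\<close>

definition tuples :: "nat \<Rightarrow> nat \<Rightarrow> (nat \<times> nat) list set" where
  "tuples k r = {ts. length ts = r \<and> (\<forall>(i, j)\<in>set ts. 1 \<le> i \<and> i < j \<and> j \<le> k) \<and> sorted (map snd ts)}"

definition perm_of :: "(nat \<times> nat) list \<Rightarrow> nat \<Rightarrow> nat" where
  "perm_of ts = foldr (\<circ>) (map (\<lambda>(i, j). transpose i j) ts) id"

lemma perm_of_Nil [simp]: "perm_of [] = id"
  by (simp add: perm_of_def)

lemma perm_of_snoc: "perm_of (ts @ [(i, j)]) = perm_of ts \<circ> transpose i j"
  by (induction ts) (auto simp: perm_of_def o_assoc)

lemma finite_tuples [simp]: "finite (tuples k r)"
proof (rule finite_subset)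
  show "tuples k r \<subseteq> {ts. set ts \<subseteq> {1..k} \<times> {1..k} \<and> length ts = r}"
    by (auto simp: tuples_def)
  show "finite {ts. set ts \<subseteq> {1..k} \<times> {1..k} \<and> length ts = r}"
    by (rule finite_lists_length_eq) simp
qed

lemma tuples_0 [simp]: "tuples k 0 = {[]}"
  by (auto simp: tuples_def)

lemma tuples_0_Suc [simp]: "tuples 0 (Suc r) = {}"
  by (auto simp: tuples_def length_Suc_conv)

text \<open>By monotonicity the entry \<open>Suc k\<close>, if it is used at all, occurs in the last
  step. This is the recurrence of complete homogeneous polynomials in the last variable.\<close>

lemma tuples_Suc_Suc:
  "tuples (Suc k) (Suc r) = tuples k (Suc r) \<union> (\<lambda>(ts, i). ts @ [(i, Suc k)]) ` (tuples (Suc k) r \<times> {1..<Suc k})"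
    (is "?L = ?A \<union> ?B")
proof (intro equalityI subsetI)
  fix us assume us: "us \<in> ?L"
  then obtain ts e where ts: "us = ts @ [e]" by (cases us rule: rev_cases) (auto simp: tuples_def)
  obtain i j where e: "e = (i, j)" by (cases e)
  show "us \<in> ?A \<union> ?B"
  proof (cases "j = Suc k")
    case True
    then have "us \<in> ?B" using us unfolding ts e
      by (intro image_eqI[of _ _ "(ts, i)"]) (auto simp: tuples_def sorted_append)
    then show ?thesis by blast
  next
    case False
    then have "us \<in> ?A" using us unfolding ts e
      by (fastforce simp: tuples_def sorted_append)
    then show ?thesis by blast
  qed
next
  fix us assume "us \<in> ?A \<union> ?B"
  then show "us \<in> ?L"
    by (fastforce simp: tuples_def sorted_append)
qed

lemma sum_tuples_Suc_Suc:
  "(\<Sum>us\<in>tuples (Suc k) (Suc r). F us) = (\<Sum>us\<in>tuples k (Suc r). F us)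
     + (\<Sum>ts\<in>tuples (Suc k) r. \<Sum>i\<in>{1..<Suc k}. F (ts @ [(i, Suc k)]))"
proof -
  let ?B = "(\<lambda>(ts, i). ts @ [(i, Suc k)]) ` (tuples (Suc k) r \<times> {1..<Suc k})"
  have "tuples k (Suc r) \<inter> ?B = {}" by (auto simp: tuples_def)
  then have "(\<Sum>us\<in>tuples (Suc k) (Suc r). F us) = (\<Sum>us\<in>tuples k (Suc r). F us) + (\<Sum>us\<in>?B. F us)"
    unfolding tuples_Suc_Suc by (intro sum.union_disjoint) auto
  also have "(\<Sum>us\<in>?B. F us) = (\<Sum>(ts, i)\<in>tuples (Suc k) r \<times> {1..<Suc k}. F (ts @ [(i, Suc k)]))"
    by (subst sum.reindex) (auto simp: inj_on_def case_prod_unfold)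
  also have "\<dots> = (\<Sum>ts\<in>tuples (Suc k) r. \<Sum>i\<in>{1..<Suc k}. F (ts @ [(i, Suc k)]))"
    by (rule sum.cartesian_product[symmetric])
  finally show ?thesis .
qed

lemma card_tuples_Suc_Suc: "card (tuples (Suc k) (Suc r)) = card (tuples k (Suc r)) + k * card (tuples (Suc k) r)"
  using sum_tuples_Suc_Suc[of "\<lambda>_. 1::nat" k r] by simp

text \<open>The generating function of the counts is the product of 1/(1 - j x) over j < k. The
  recurrence contributes one factor per induction step, here as a bound on partial sums.\<close>

lemma summable_tuples:
  fixes x :: real
  assumes x: "0 \<le> x"
  shows "(\<And>j. j < k \<Longrightarrow> real j * x < 1) \<Longrightarrow> summable (\<lambda>r. real (card (tuples k r)) * x ^ r)"
proof (induction k)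
  case 0
  have "card (tuples 0 r) = 0" if "r \<noteq> 0" for r using that by (cases r) auto
  then show ?case by (intro summable_finite[of "{0}"]) auto
next
  case (Suc k)
  define f where "f = (\<lambda>k r. real (card (tuples k r)) * x ^ r)"
  have nonneg: "0 \<le> f k r" for k r unfolding f_def using x by simp
  have sm: "summable (f k)" unfolding f_def using Suc by simp
  have kx: "real k * x < 1" using Suc.prems by simp
  define M where "M = suminf (f k)"
  \<comment> \<open>The bound is the solution S of S = M + k x S, so the recurrence preserves
    it.\<close>
  have "(\<Sum>r<R. f (Suc k) r) \<le> M / (1 - real k * x)" for R
  proof (induction R)
    case 0
    have "0 \<le> M" unfolding M_def by (rule suminf_nonneg[OF sm nonneg])
    then show ?case using kx by simp
  next
    case (Suc R)
    have "(\<Sum>r<Suc R. f (Suc k) r) = f (Suc k) 0 + (\<Sum>r<R. f (Suc k) (Suc r))"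
      by (rule sum.lessThan_Suc_shift)
    also have "(\<Sum>r<R. f (Suc k) (Suc r)) = (\<Sum>r<R. f k (Suc r) + real k * x * f (Suc k) r)"
      by (intro sum.cong refl) (simp add: f_def card_tuples_Suc_Suc algebra_simps)
    also have "f (Suc k) 0 + \<dots> = (f k 0 + (\<Sum>r<R. f k (Suc r))) + real k * x * (\<Sum>r<R. f (Suc k) r)"
      by (simp add: sum.distrib sum_distrib_left f_def)
    also have "f k 0 + (\<Sum>r<R. f k (Suc r)) = (\<Sum>r<Suc R. f k r)"
      by (rule sum.lessThan_Suc_shift[symmetric])
    also have "\<dots> \<le> M" unfolding M_def by (rule sum_le_suminf[OF sm]) (auto simp: nonneg)
    also have "M + real k * x * (\<Sum>r<R. f (Suc k) r) \<le> M + real k * x * (M / (1 - real k * x))"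
      using Suc x by (intro add_left_mono mult_left_mono) auto
    also have "\<dots> = M / (1 - real k * x)" using kx by (simp add: field_simps)
    finally show ?case by simp
  qed
  then show ?case using nonneg unfolding f_def by (intro summableI_nonneg_bounded)
qed

section \<open>Complete homogeneous polynomials in the Jucys--Murphy elements\<close>

context sym_algebra
begin

lemma perm_of_G: "ts \<in> tuples k r \<Longrightarrow> k \<le> d \<Longrightarrow> perm_of ts \<in> G"
proof (induction ts arbitrary: r rule: rev_induct)
  case (snoc e ts)
  obtain i j where e: "e = (i, j)" by (cases e)
  have "ts \<in> tuples k (r - 1)" using snoc.prems by (auto simp: tuples_def sorted_append)
  then have "perm_of ts \<in> G" by (rule snoc.IH) (rule snoc.prems)
  moreover have "transpose i j \<in> G" using snoc.prems by (intro transpose_G) (auto simp: e tuples_def)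
  ultimately show ?case unfolding e perm_of_snoc by (rule comp_G)
qed simp

text \<open>The complete homogeneous polynomial of degree \<open>r\<close> in \<open>JM 1\<close>,
  ..., \<open>JM k\<close>; its coefficient at a permutation counts the monotone factorizations of
  that permutation.\<close>

definition w :: "nat \<Rightarrow> nat \<Rightarrow> (nat \<Rightarrow> nat) \<Rightarrow> complex" where
  "w k r = (\<Sum>ts\<in>tuples k r. \<delta> (perm_of ts))"

lemma w_A: "k \<le> d \<Longrightarrow> w k r \<in> A"
  unfolding w_def using perm_of_G by (intro A_sum \<delta>_A)

lemma w_Suc_Suc:
  assumes "Suc k \<le> d"
  shows "w (Suc k) (Suc r) = w k (Suc r) + w (Suc k) r \<star> JM (Suc k)"
  unfolding w_def JM_def sum_tuples_Suc_Suc mul_sum_left mul_sum_right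
  by (subst (2) sum.swap, intro arg_cong2[of _ _ _ _ "(+)"] sum.cong refl)
     (use assms in \<open>auto simp: perm_of_snoc \<delta>_mul_\<delta> perm_of_G[OF _ assms]\<close>)

lemma w_app: "w k r p = (\<Sum>ts\<in>tuples k r. if p = perm_of ts then 1 else 0)"
  by (simp add: w_def sum_apply_fun \<delta>_app)

lemma norm_w_le: "norm (w k r p) \<le> real (card (tuples k r))"
proof -
  have "norm (w k r p) \<le> (\<Sum>ts\<in>tuples k r. norm (if p = perm_of ts then 1 else 0 :: complex))"
    unfolding w_app by (rule norm_sum)
  also have "\<dots> \<le> (\<Sum>ts\<in>tuples k r. 1)" by (intro sum_mono) auto
  finally show ?thesis by simp
qed

section \<open>The inverse of the product and the walk counts\<close>

context
  fixes N :: nat and x :: real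
  assumes N: "d \<le> N" "1 \<le> d" and x: "x = 1 / real N"
begin

lemma x_nonneg [simp]: "0 \<le> x"
  by (simp add: x)

lemma summable_card_tuples: "k \<le> d \<Longrightarrow> summable (\<lambda>r. real (card (tuples k r)) * x ^ r)"
proof (rule summable_tuples)
  fix j assume "k \<le> d" "j < k"
  then have "real j < real N" using N by simp
  then show "real j * x < 1" using N by (simp add: x)
qed simp

text \<open>The generating series of the elements \<open>w k r\<close> at -1/N, taken coefficient by
  coefficient so that convergence concerns complex series only.\<close>

definition H :: "nat \<Rightarrow> (nat \<Rightarrow> nat) \<Rightarrow> complex" where
  "H k p = (\<Sum>r. (- of_real x) ^ r * w k r p)"

lemma H_sums: "k \<le> d \<Longrightarrow> (\<lambda>r. (- of_real x) ^ r * w k r p) sums H k p"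
proof -
  assume k: "k \<le> d"
  have "summable (\<lambda>r. (- of_real x) ^ r * w k r p)"
  proof (rule summable_comparison_test'[OF summable_card_tuples[OF k], of 0])
    fix r
    have "norm ((- of_real x) ^ r * w k r p) = x ^ r * norm (w k r p)"
      by (simp add: norm_mult norm_power)
    also have "\<dots> \<le> x ^ r * real (card (tuples k r))"
      by (intro mult_left_mono norm_w_le) simp
    finally show "norm ((- of_real x) ^ r * w k r p) \<le> real (card (tuples k r)) * x ^ r"
      by (simp add: mult.commute)
  qed
  then show ?thesis unfolding H_def by (rule summable_sums)
qed

lemma H_A: "k \<le> d \<Longrightarrow> H k \<in> A"
  unfolding group_algebra_def H_def using A_outside[OF w_A] by simp

lemma H_0: "H 0 = \<delta> id"
proof
  fix p
  have "(\<lambda>r. (- of_real x) ^ r * w 0 r p) sums (\<Sum>r\<in>{0}. (- of_real x) ^ r * w 0 r p)"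
  proof (rule sums_finite)
    fix r :: nat assume "r \<notin> {0}"
    then show "(- of_real x) ^ r * w 0 r p = 0" by (cases r) (auto simp: w_app)
  qed simp
  then show "H 0 p = \<delta> id p" using H_sums[of 0 p] sums_unique2 by (fastforce simp: w_app \<delta>_app)
qed

text \<open>The recurrence of \<open>w\<close>, multiplied by powers of \<open>- x\<close> and
  summed: adjoining the variable \<open>JM (Suc k)\<close> divides the generating series by
  \<open>\<delta> id + x \<cdot> JM (Suc k)\<close>.\<close>

lemma H_Suc:
  assumes k: "Suc k \<le> d"
  shows "H (Suc k) \<star> (\<delta> id + of_real x \<cdot> JM (Suc k)) = H k"
proof (rule A_eqI)
  fix p assume p: "p \<in> G"
  let ?q = "\<lambda>m. p \<circ> transpose m (Suc k)"
  let ?y = "- complex_of_real x"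
  have JM_app: "(u \<star> JM (Suc k)) p = (\<Sum>m\<in>{1..<Suc k}. u (?q m))" for u
    unfolding JM_def mul_sum_right sum_apply_fun
    by (intro sum.cong refl) (use k p in \<open>auto simp: mul_\<delta>_app\<close>)
  \<comment> \<open>Multiplication by \<open>JM (Suc k)\<close> is a finite sum of translated
    coefficients and so passes through the series.\<close>
  have "(\<lambda>r. \<Sum>m\<in>{1..<Suc k}. ?y ^ r * w (Suc k) r (?q m)) sums (\<Sum>m\<in>{1..<Suc k}. H (Suc k) (?q m))"
    by (intro sums_sum H_sums k)
  then have "(\<lambda>r. ?y ^ r * (w (Suc k) r \<star> JM (Suc k)) p) sums (H (Suc k) \<star> JM (Suc k)) p"
    unfolding JM_app sum_distrib_left .
  then have 1: "(\<lambda>r. ?y * (?y ^ r * (w (Suc k) r \<star> JM (Suc k)) p)) sums (?y * (H (Suc k) \<star> JM (Suc k)) p)"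
    by (rule sums_mult)
  have "(\<lambda>r. ?y ^ Suc r * w k (Suc r) p) sums (H k p - ?y ^ 0 * w k 0 p)"
    using H_sums[of k p] k by (subst sums_Suc_iff) simp
  from sums_add[OF this 1]
  have "(\<lambda>r. ?y ^ Suc r * w (Suc k) (Suc r) p) sums (H k p - w k 0 p + ?y * (H (Suc k) \<star> JM (Suc k)) p)"
    by (simp add: w_Suc_Suc[OF k] plus_fun_apply algebra_simps)
  moreover have "(\<lambda>r. ?y ^ Suc r * w (Suc k) (Suc r) p) sums (H (Suc k) p - ?y ^ 0 * w (Suc k) 0 p)"
    using H_sums[of "Suc k" p] k by (subst sums_Suc_iff) simp
  ultimately have "H k p - w k 0 p + ?y * (H (Suc k) \<star> JM (Suc k)) p = H (Suc k) p - ?y ^ 0 * w (Suc k) 0 p"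
    by (rule sums_unique2)
  \<comment> \<open>The terms of degree 0 cancel: \<open>w k 0\<close> and
    \<open>w (Suc k) 0\<close> both come from the empty sequence alone.\<close>
  then have "H (Suc k) p + of_real x * (H (Suc k) \<star> JM (Suc k)) p = H k p"
    by (simp add: w_app diff_eq_eq add.commute)
  then show "(H (Suc k) \<star> (\<delta> id + of_real x \<cdot> JM (Suc k))) p = H k p"
    using H_A[OF k] by (simp add: mul_add_right plus_fun_apply)
qed (use k H_A in auto)

text \<open>The factors are cancelled from the largest index downwards; since they commute, the one
  to be cancelled can be brought next to \<open>H\<close>.\<close>

lemma H_prodJ: "k \<le> d \<Longrightarrow> H k \<star> prodJ (of_real x) k = \<delta> id"
proof (induction k)
  case 0
  show ?case unfolding H_0 prodJ.simps by (rule one_mul) simp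
next
  case (Suc k)
  let ?Y = "\<delta> id + of_real x \<cdot> JM (Suc k)"
  have "prodJ (of_real x) k \<star> ?Y = ?Y \<star> prodJ (of_real x) k"
    using supp_JM_commute[OF supp_prodJ[of k "of_real x"]] Suc.prems
    by (simp add: mul_add_left mul_add_right)
  then have "H (Suc k) \<star> prodJ (of_real x) (Suc k) = (H (Suc k) \<star> ?Y) \<star> prodJ (of_real x) k"
    by (simp add: mul_assoc)
  then show ?case using Suc by (simp add: H_Suc)
qed

lemma prodJ_H: "prodJ (of_real x) d \<star> H d = \<delta> id"
  using H_prodJ[of d] central_commute[OF central_prodJ H_A[OF order_refl]] by simp

lemma central_H: "central (H d)"
proof (rule centralI_commute[OF H_A[OF order_refl]])
  fix y assume y: "y \<in> A"
  let ?z = "prodJ (of_real x) d"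
  \<comment> \<open>The identity is inserted after \<open>y\<close> as
    \<open>?z \<star> H d\<close>; then the central \<open>?z\<close> crosses \<open>y\<close> and
    cancels against the left \<open>H d\<close>.\<close>
  have "H d \<star> y = H d \<star> (y \<star> ?z) \<star> H d"
    using y H_A[of d] by (simp add: mul_assoc prodJ_H)
  also have "\<dots> = H d \<star> ?z \<star> y \<star> H d"
    using central_commute[OF central_prodJ y] by (simp add: mul_assoc)
  also have "\<dots> = y \<star> H d" using y by (simp add: H_prodJ)
  finally show "H d \<star> y = y \<star> H d" .
qed

text \<open>\<open>om\<close> is multiplicative on central elements and \<open>H d\<close> inverts
  the product. In particular \<open>Omega N \<nu>\<close> is nonzero, so \<open>inverse\<close> is a
  genuine inverse here.\<close>

lemma om_H:
  assumes "\<nu> \<in> partitions_of d"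
  shows "young.om d \<nu> (H d) = inverse (Omega N \<nu>)"
proof -
  interpret Y: young d \<nu> by standard fact
  have "of_real x = (1 / of_nat N :: complex)" using x by simp
  then have "Y.om (H d) * Omega N \<nu> = Y.om (H d \<star> prodJ (of_real x) d)"
    by (simp add: Y.Omega_eq Y.om_mul[OF central_H central_prodJ])
  also have "\<dots> = 1" by (simp add: H_prodJ Y.om_one)
  finally show ?thesis by (metis inverse_unique mult.commute)
qed

lemma W_eq: "W d r \<alpha> \<beta> = (\<Sum>\<rho>\<in>conj_class d \<alpha>. card {ts \<in> tuples d r. \<rho> \<circ> perm_of ts \<in> conj_class d \<beta>})"
proof -
  have "monotone_walks d r \<alpha> \<beta> = (SIGMA \<rho>:conj_class d \<alpha>. {ts \<in> tuples d r. \<rho> \<circ> perm_of ts \<in> conj_class d \<beta>})"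
    unfolding monotone_walks_def tuples_def perm_of_def by auto
  then show ?thesis by (simp add: W_def)
qed

lemma W_le: "W d r \<alpha> \<beta> \<le> card (conj_class d \<alpha>) * card (tuples d r)"
proof -
  have "W d r \<alpha> \<beta> \<le> (\<Sum>\<rho>\<in>conj_class d \<alpha>. card (tuples d r))"
    unfolding W_eq by (intro sum_mono card_mono) auto
  then show ?thesis by simp
qed

text \<open>A step sequence leads from \<rho> to \<sigma> exactly if its product is
  \<open>inv \<rho> \<circ> \<sigma>\<close>. Classes are closed under inversion, so \<sigma> may be
  replaced by its inverse, which gives the arguments occurring in the coefficient at
  \<open>id\<close> of a product with two class sums.\<close>

lemma W_eq_w: "of_nat (W d r \<alpha> \<beta>) = (\<Sum>\<rho>\<in>conj_class d \<alpha>. \<Sum>\<sigma>\<in>conj_class d \<beta>. w d r (inv \<rho> \<circ> inv \<sigma>))"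
  unfolding W_eq of_nat_sum
proof (rule sum.cong[OF refl])
  fix \<rho> assume "\<rho> \<in> conj_class d \<alpha>"
  then have \<rho>: "\<rho> \<in> G" by (rule conj_class_G)
  let ?C = "conj_class d \<beta>"
  have bij: "bij_betw inv ?C ?C"
    by (rule bij_betwI[where g = inv]) (auto simp: conj_class_inv conj_class_G dest: conj_class_G)
  have "(\<Sum>\<sigma>\<in>?C. w d r (inv \<rho> \<circ> inv \<sigma>)) = (\<Sum>\<sigma>\<in>?C. w d r (inv \<rho> \<circ> \<sigma>))"
    by (rule sum.reindex_bij_betw[OF bij])
  also have "\<dots> = (\<Sum>ts\<in>tuples d r. \<Sum>\<sigma>\<in>?C. if inv \<rho> \<circ> \<sigma> = perm_of ts then 1 else 0)"
    unfolding w_app by (rule sum.swap)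
  also have "\<dots> = (\<Sum>ts\<in>tuples d r. \<Sum>\<sigma>\<in>?C. if \<sigma> = \<rho> \<circ> perm_of ts then 1 else 0)"
  proof (intro sum.cong refl if_cong)
    fix ts \<sigma>
    show "inv \<rho> \<circ> \<sigma> = perm_of ts \<longleftrightarrow> \<sigma> = \<rho> \<circ> perm_of ts" using \<rho> by (metis G_cancel(1,2))
  qed
  also have "\<dots> = (\<Sum>ts\<in>tuples d r. if \<rho> \<circ> perm_of ts \<in> ?C then 1 else 0)"
    by (intro sum.cong refl) (simp add: sum.delta)
  also have "\<dots> = of_nat (card {ts \<in> tuples d r. \<rho> \<circ> perm_of ts \<in> ?C})"
    by (simp flip: sum.inter_filter)
  finally show "of_nat (card {ts \<in> tuples d r. \<rho> \<circ> perm_of ts \<in> ?C}) = (\<Sum>\<sigma>\<in>?C. w d r (inv \<rho> \<circ> inv \<sigma>))"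
    by simp
qed

lemma term_eq: "(- of_real x) ^ r * of_nat m = ((-1) ^ r * of_nat m / of_nat N ^ r :: complex)"
  by (simp add: x power_divide power_minus[of "1 / _"])

lemma clsum_H_clsum: "(clsum \<alpha> \<star> H d \<star> clsum \<beta>) id = (\<Sum>\<rho>\<in>conj_class d \<alpha>. \<Sum>\<sigma>\<in>conj_class d \<beta>. H d (inv \<rho> \<circ> inv \<sigma>))"
proof -
  have "(clsum \<alpha> \<star> H d \<star> clsum \<beta>) id = (\<Sum>\<sigma>\<in>conj_class d \<beta>. \<Sum>\<rho>\<in>conj_class d \<alpha>. (\<delta> \<rho> \<star> H d \<star> \<delta> \<sigma>) id)"
    by (simp add: clsum_def mul_sum_left mul_sum_right sum_apply_fun)
  also have "\<dots> = (\<Sum>\<sigma>\<in>conj_class d \<beta>. \<Sum>\<rho>\<in>conj_class d \<alpha>. H d (inv \<rho> \<circ> inv \<sigma>))"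
    by (intro sum.cong refl) (simp add: mul_\<delta>_app \<delta>_mul_app conj_class_G)
  finally show ?thesis by (simp add: sum.swap[of _ "conj_class d \<beta>"])
qed

text \<open>The Plancherel average is applied to
  \<open>clsum \<alpha> \<star> H d \<star> clsum \<beta>\<close>: its scalar on each module is the
  integrand, and its coefficient at \<open>id\<close> is the walk series.\<close>

lemma plancherel_walks:
  "plancherel_expectation d (\<lambda>\<nu>. omega d \<alpha> \<nu> * inverse (Omega N \<nu>) * omega d \<beta> \<nu>)
     = (\<Sum>r. (-1) ^ r * of_nat (W d r \<alpha> \<beta>) / of_nat N ^ r)"
proof -
  let ?z = "clsum \<alpha> \<star> H d \<star> clsum \<beta>"
  have z: "central ?z" by (intro central_mul central_clsum central_H)
  have om: "young.om d \<nu> ?z = omega d \<alpha> \<nu> * inverse (Omega N \<nu>) * omega d \<beta> \<nu>" if "\<nu> \<in> partitions_of d" for \<nu>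
  proof -
    interpret Y: young d \<nu> by standard fact
    show ?thesis
      using om_H[OF that]
      by (simp add: Y.om_mul central_mul central_clsum central_H Y.omega_eq)
  qed
  have "plancherel_expectation d (\<lambda>\<nu>. omega d \<alpha> \<nu> * inverse (Omega N \<nu>) * omega d \<beta> \<nu>)
      = plancherel_expectation d (\<lambda>\<nu>. young.om d \<nu> ?z)"
    unfolding plancherel_expectation_def by (intro sum.cong refl) (simp add: om)
  also have "\<dots> = ?z id" by (rule plancherel_om[OF z])
  finally have eq: "plancherel_expectation d (\<lambda>\<nu>. omega d \<alpha> \<nu> * inverse (Omega N \<nu>) * omega d \<beta> \<nu>) = ?z id" .
  have "(\<lambda>r. \<Sum>\<rho>\<in>conj_class d \<alpha>. \<Sum>\<sigma>\<in>conj_class d \<beta>. (- of_real x) ^ r * w d r (inv \<rho> \<circ> inv \<sigma>)) sums ?z id"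
    unfolding clsum_H_clsum by (intro sums_sum H_sums order_refl)
  then have "(\<lambda>r. (- of_real x) ^ r * of_nat (W d r \<alpha> \<beta>)) sums ?z id"
    by (simp add: W_eq_w sum_distrib_left)
  then show ?thesis unfolding eq term_eq by (rule sums_unique)
qed

lemma summable_walks: "summable (\<lambda>r. norm ((-1) ^ r * of_nat (W d r \<alpha> \<beta>) / of_nat N ^ r :: complex))"
proof (rule summable_comparison_test'[OF summable_mult[OF summable_card_tuples[OF order_refl], of "real (card (conj_class d \<alpha>))"], of 0])
  fix r
  have "norm (norm ((-1) ^ r * of_nat (W d r \<alpha> \<beta>) / of_nat N ^ r :: complex)) = real (W d r \<alpha> \<beta>) * x ^ r"
    by (simp add: norm_mult norm_divide norm_power x power_divide)
  also have "\<dots> \<le> real (card (conj_class d \<alpha>) * card (tuples d r)) * x ^ r"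
    using W_le[of r \<alpha> \<beta>] x by (intro mult_right_mono) (auto simp del: of_nat_mult)
  finally show "norm (norm ((-1) ^ r * of_nat (W d r \<alpha> \<beta>) / of_nat N ^ r :: complex))
     \<le> real (card (conj_class d \<alpha>)) * (real (card (tuples d r)) * x ^ r)"
    by (simp add: mult.assoc)
qed

end

end

theorem theorem3p1:
  fixes d N :: nat and \<alpha> \<beta> :: "nat list"
  assumes "1 \<le> d" and "d \<le> N"
    and "\<alpha> \<in> partitions_of d" and "\<beta> \<in> partitions_of d"
  shows "plancherel_expectation d (\<lambda>\<nu>. omega d \<alpha> \<nu> * inverse (Omega N \<nu>) * omega d \<beta> \<nu>)
           = (\<Sum>r. (-1) ^ r * of_nat (W d r \<alpha> \<beta>) / of_nat N ^ r)
       \<and> plancherel_expectation d (\<lambda>\<nu>. inverse (Omega N \<nu>) * omega d \<beta> \<nu>)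
           = (\<Sum>r. (-1) ^ r * of_nat (W_id d r \<beta>) / of_nat N ^ r)
       \<and> summable (\<lambda>r. norm ((-1) ^ r * of_nat (W d r \<alpha> \<beta>) / of_nat N ^ r :: complex))
       \<and> summable (\<lambda>r. norm ((-1) ^ r * of_nat (W_id d r \<beta>) / of_nat N ^ r :: complex))"
proof -
  note walks = sym_algebra.plancherel_walks[OF assms(2,1) refl]
    and summable = sym_algebra.summable_walks[OF assms(2,1) refl]
  have "omega d (replicate d 1) \<nu> = 1" if "\<nu> \<in> partitions_of d" for \<nu>
  proof -
    interpret young d \<nu> by standard fact
    show ?thesis by (simp add: omega_eq clsum_replicate_1 om_one)
  qed
  then have "plancherel_expectation d (\<lambda>\<nu>. inverse (Omega N \<nu>) * omega d \<beta> \<nu>)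
      = plancherel_expectation d (\<lambda>\<nu>. omega d (replicate d 1) \<nu> * inverse (Omega N \<nu>) * omega d \<beta> \<nu>)"
    unfolding plancherel_expectation_def by (intro sum.cong refl) simp
  then show ?thesis
    unfolding W_id_def using walks summable by simp
qed

end
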